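(* Assume GCH. For every singular cardinal $\mu$ and every sequence $\bar p=\langle p_\delta:\delta<\mu^+\rangle$ of partitions $p_\delta:[\mu^+]^2\to\theta_\delta$ with $\theta_\delta\le\mu$, $\Pr_0(\mu^+,\mu^+,\mu^+,\operatorname{cf}(\mu))_{\bar p}$ holds.
   Context: $\Pr_0(\kappa,\mu,\lambda,\chi)_p$ for $p:[\kappa]^2\to\theta$: there is $f:[\kappa]^2\to\lambda$ such that for every $\xi<\chi$, every pairwise disjoint family $\mathcal A\subseteq[\kappa]^\xi$ with $|\mathcal A|=\mu$, and every matrix $\langle\zeta_{i,j}:i,j<\xi\rangle$ of elements of $\lambda^\theta$, there are $a,b\in\mathcal A$ with $\max a<\min b$ and $f(a(i),b(j))=\zeta_{i,j}(p(a(i),b(j)))$ for all $i,j<\xi$, where $a(i),b(j)$ are the $i$-th, $j$-th elements in increasing order. With a sequence $\bar p=\langle p_\delta\rangle$: a single $f$ witnesses this for every $p_\delta$. *)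

theory Defs
  imports Main
begin

unbundle cardinal_syntax

(* Cardinals/ordinals are represented as in Main's BNF cardinal library:
   an ordinal is a well-order relation, a cardinal is a Card_order (initial ordinal). *)

definition ltw :: "'a rel \<Rightarrow> 'a \<Rightarrow> 'a \<Rightarrow> bool" where
  "ltw r a b \<longleftrightarrow> (a, b) \<in> r \<and> a \<noteq> b"

definition GCH_on :: "'a itself \<Rightarrow> bool" where
  "GCH_on _ \<longleftrightarrow> (\<forall>A :: 'a set. infinite A \<longrightarrow>
      (\<forall>C :: 'a set set. card_of A <o card_of C \<longrightarrow> card_of (Pow A) \<le>o card_of C))"

definition singular_card :: "'a rel \<Rightarrow> bool" where
  "singular_card m \<longleftrightarrow> Card_order m \<and> infinite (Field m) \<and> \<not> regularCard m"

definition less_cf :: "'b set \<Rightarrow> 'a rel \<Rightarrow> bool" where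
  "less_cf X m \<longleftrightarrow> (\<forall>C. C \<subseteq> Field m \<and> cofinal C m \<longrightarrow> card_of X <o card_of C)"

definition enumerates :: "'a rel \<Rightarrow> 'a rel \<Rightarrow> 'a set \<Rightarrow> ('a \<Rightarrow> 'a) \<Rightarrow> bool" where
  "enumerates x k a e \<longleftrightarrow> bij_betw e (Field x) a \<and>
     (\<forall>i\<in>Field x. \<forall>j\<in>Field x. (i, j) \<in> x \<longleftrightarrow> (e i, e j) \<in> k)"

text \<open>Pr_0(kappa, kappa, kappa, cf(mu))_pbar, where kappa (= lambda = the size of the
  families) is the ordinal k, the partitions are p delta : [kappa]^2 \<rightarrow> th delta for
  delta \<in> Field k, and chi = cf(m).  Pairs {alpha < beta} are written p delta alpha beta.
  Families: all pairwise disjoint A \<subseteq> [kappa]^xi with card_of A = kappa, xi < cf(m),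
  where xi is any well-order x (ordinal) on the type; a(i) = E a i.\<close>
definition Pr0_seq :: "'a rel \<Rightarrow> 'a rel \<Rightarrow> ('a \<Rightarrow> 'a set) \<Rightarrow> ('a \<Rightarrow> 'a \<Rightarrow> 'a \<Rightarrow> 'a) \<Rightarrow> bool" where
  "Pr0_seq k m th p \<longleftrightarrow>
    (\<exists>f :: 'a \<Rightarrow> 'a \<Rightarrow> 'a.
      (\<forall>\<alpha>\<in>Field k. \<forall>\<beta>\<in>Field k. ltw k \<alpha> \<beta> \<longrightarrow> f \<alpha> \<beta> \<in> Field k) \<and>
      (\<forall>\<delta>\<in>Field k. \<forall>x :: 'a rel. \<forall>\<A> :: 'a set set. \<forall>E :: 'a set \<Rightarrow> 'a \<Rightarrow> 'a.
         \<forall>\<zeta> :: 'a \<Rightarrow> 'a \<Rightarrow> 'a \<Rightarrow> 'a.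
         Well_order x \<and> less_cf (Field x) m \<and>
         (\<forall>a\<in>\<A>. a \<subseteq> Field k \<and> enumerates x k a (E a)) \<and>
         (\<forall>a\<in>\<A>. \<forall>b\<in>\<A>. a \<noteq> b \<longrightarrow> a \<inter> b = {}) \<and>
         card_of \<A> =o k \<and>
         (\<forall>i\<in>Field x. \<forall>j\<in>Field x. \<forall>c\<in>th \<delta>. \<zeta> i j c \<in> Field k)
         \<longrightarrow> (\<exists>a\<in>\<A>. \<exists>b\<in>\<A>. (\<forall>\<alpha>\<in>a. \<forall>\<beta>\<in>b. ltw k \<alpha> \<beta>) \<and>
               (\<forall>i\<in>Field x. \<forall>j\<in>Field x.
                  f (E a i) (E b j) = \<zeta> i j (p \<delta> (E a i) (E b j))))))"

end

theory Submission
  imports Defs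
begin

text \<open>
  By GCH, \<open>\<mu>\<close> is a strong limit and \<open>2^\<mu> = \<mu>\<^sup>+\<close>. Since \<open>(\<mu>\<^sup>+)^\<mu> = \<mu>\<^sup>+\<close>, a colour in \<open>\<mu>\<^sup>+\<close> can code a pair of an
  index \<open>\<delta>\<close> and a map \<open>h\<close> from \<open>\<theta>\<^sub>\<delta>\<close> to \<open>\<mu>\<^sup>+\<close>, to be evaluated at \<open>p\<^sub>\<delta>(\<alpha>, \<beta>)\<close>; so the partitions disappear.
  By injecting each \<open>\<beta> < \<mu>\<^sup>+\<close> into \<open>\<mu>\<close> and by tagging ordinals with subsets of \<open>\<mu>\<close>, a matrix of colours
  in \<open>\<mu>\<^sup>+\<close> reduces to a single colour in \<open>\<mu>\<close> that is constant on \<open>a \<times> b\<close>.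

  For the latter, enumerate in type \<open>\<mu>\<^sup>+\<close> all sequences \<open>\<langle>E\<^sub>i\<rangle>\<close> of clubs \<open>E\<^sub>i\<close> of \<open>\<lambda>\<^sub>i = \<chi>\<^sub>i\<^sup>+\<close>, where \<open>\<chi>\<^sub>i\<close> runs
  through the infinite cardinals below \<open>\<mu>\<close>, and for each \<open>\<beta>\<close> choose clubs \<open>C\<^sub>\<beta>\<^sub>,\<^sub>i\<close> of \<open>\<lambda>\<^sub>i\<close> that are eventually
  included in each of the sequences enumerated before \<open>\<beta>\<close>. With \<open>f\<^sub>\<beta>(i)\<close> a lower bound of \<open>C\<^sub>\<beta>\<^sub>,\<^sub>i\<close>, let
  \<open>i\<close> be last with \<open>f\<^sub>\<beta>(i) < f\<^sub>\<alpha>(i)\<close> and colour \<open>\<alpha>, \<beta>\<close> by the class of \<open>max(C\<^sub>\<beta>\<^sub>,\<^sub>i \<inter> (f\<^sub>\<alpha>(i) + 1))\<close> in a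
  partition of \<open>\<lambda>\<^sub>i\<close> into \<open>\<chi>\<^sub>i\<close> stationary sets.
\<close>

section \<open>Successor cardinals\<close>

lemma ltw_trans: "Well_order r \<Longrightarrow> ltw r a b \<Longrightarrow> ltw r b c \<Longrightarrow> ltw r a c"
  unfolding ltw_def order_on_defs by (metis antisymD transD)

lemma ltw_le_trans: "Well_order r \<Longrightarrow> ltw r a b \<Longrightarrow> (b, c) \<in> r \<Longrightarrow> ltw r a c"
  unfolding ltw_def order_on_defs by (metis antisymD transD)

lemma le_ltw_trans: "Well_order r \<Longrightarrow> (a, b) \<in> r \<Longrightarrow> ltw r b c \<Longrightarrow> ltw r a c"
  unfolding ltw_def order_on_defs by (metis antisymD transD)

lemma ltw_asym: "Well_order r \<Longrightarrow> ltw r a b \<Longrightarrow> \<not> (b, a) \<in> r"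
  unfolding ltw_def order_on_defs by (metis antisymD)

lemma not_ltw: "Well_order r \<Longrightarrow> a \<in> Field r \<Longrightarrow> b \<in> Field r \<Longrightarrow> \<not> ltw r a b \<Longrightarrow> (b, a) \<in> r"
  unfolding ltw_def order_on_defs unfolding total_on_def by (metis refl_onD)

lemma ltw_imp_le: "ltw r a b \<Longrightarrow> (a, b) \<in> r"
  unfolding ltw_def by simp

lemma ltw_Field: "ltw r a b \<Longrightarrow> a \<in> Field r" "ltw r a b \<Longrightarrow> b \<in> Field r"
  unfolding ltw_def Field_def by auto

lemma underS_iff_ltw: "a \<in> underS r b \<longleftrightarrow> ltw r a b"
  unfolding ltw_def underS_def by auto

lemma Well_order_refl: "Well_order r \<Longrightarrow> a \<in> Field r \<Longrightarrow> (a, a) \<in> r"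
  unfolding order_on_defs by (metis refl_onD)

lemma Well_order_least:
  assumes "Well_order r" "x \<in> Field r" "P x"
  shows "\<exists>y\<in>Field r. P y \<and> (\<forall>z\<in>Field r. P z \<longrightarrow> (y, z) \<in> r)"
proof -
  have "wo_rel r" using assms(1) by (simp add: wo_rel_def)
  then have "\<exists>y\<in>{x \<in> Field r. P x}. \<forall>z\<in>{x \<in> Field r. P x}. (y, z) \<in> r"
    using wo_rel.minim_in[of r "{x \<in> Field r. P x}"] wo_rel.minim_least[of r "{x \<in> Field r. P x}"]
      assms(2,3) by blast
  then show ?thesis by blast
qed

lemma Card_order_Well_order: "Card_order r \<Longrightarrow> Well_order r"
  by (simp add: card_order_on_well_order_on)

lemma finite_ordLess_infinite_set:
  assumes "finite A" "infinite B"
  shows "|A| <o |B|"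
  using finite_ordLess_infinite[OF card_of_Well_order card_of_Well_order] assms
  unfolding Field_card_of by blast

lemma card_of_ordLeq_refl: "|A| \<le>o |A|"
  by (rule ordIso_imp_ordLeq[OF card_of_refl])

lemma not_card_of_ordLeq: "\<not> |A| \<le>o |B| \<Longrightarrow> |B| <o |A|"
  by (simp add: not_ordLeq_iff_ordLess[OF card_of_Well_order card_of_Well_order])

text \<open>Clubs are represented by functions, via their nonzero closure points: an intersection of
  clubs then contains the club of any pointwise upper bound of the functions.\<close>

definition closure_points :: "'b rel \<Rightarrow> ('b \<Rightarrow> 'b) \<Rightarrow> 'b set" where
  "closure_points r F =
     {e \<in> Field r. (\<exists>u. ltw r u e) \<and> (\<forall>u. ltw r u e \<longrightarrow> ltw r (F u) e)}"

text \<open>The predecessor cardinal is given by a set \<open>X\<close> so that sizes of families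
  can be compared with it directly. The instances are \<open>k\<close> over \<open>Field m\<close>,
  and each \<open>L i\<close> over \<open>underS m i\<close>.\<close>

locale succ_card =
  fixes r :: "'b rel" and X :: "'c set"
  assumes Card_r: "Card_order r" and inf_X: "infinite X" and r_succ: "r =o cardSuc |X|"
begin

lemma wo_r: "Well_order r"
  using Card_r by (rule Card_order_Well_order)

lemma X_less: "|X| <o r"
  using cardSuc_greater[OF card_of_Card_order] r_succ ordIso_symmetric ordLess_ordIso_trans by blast

lemma less_imp_le_X: "|Y| <o r \<Longrightarrow> |Y| \<le>o |X|"
  using cardSuc_ordLeq_ordLess[OF card_of_Card_order card_of_Card_order] r_succ ordLess_ordIso_trans
  by blast

lemma underS_le_X: "a \<in> Field r \<Longrightarrow> |underS r a| \<le>o |X|"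
  using card_of_underS[OF Card_r] less_imp_le_X by blast

text \<open>Regularity of a successor: the closed initial segments up to the members of
  \<open>S\<close> are at most |X| many sets of size at most |X|, so their union cannot exhaust
  \<open>r\<close>.\<close>

lemma small_bounded:
  assumes "S \<subseteq> Field r" "|S| \<le>o |X|"
  shows "\<exists>y\<in>Field r. \<forall>s\<in>S. ltw r s y"
proof -
  have ins: "|insert s (underS r s)| \<le>o |X|" if "s \<in> S" for s
  proof -
    have "|{s} \<union> underS r s| \<le>o |X|"
    proof (rule card_of_Un_ordLeq_infinite_Field[of "|X|", unfolded Field_card_of])
      show "|{s}| \<le>o |X|" by (rule card_of_singl_ordLeq) (use inf_X in auto)
      show "|underS r s| \<le>o |X|" using underS_le_X that assms(1) by auto
    qed (auto simp: inf_X card_of_card_order_on)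
    then show ?thesis by simp
  qed
  let ?U = "\<Union>s\<in>S. insert s (underS r s)"
  have "|?U| \<le>o |X|"
    by (rule card_of_UNION_ordLeq_infinite[OF inf_X assms(2)]) (intro ballI ins)
  then have "|?U| <o r" using X_less by (rule ordLeq_ordLess_trans)
  have "\<not> Field r \<subseteq> ?U"
  proof
    assume "Field r \<subseteq> ?U"
    then have "|Field r| \<le>o |?U|" by (rule card_of_mono1)
    then have "r \<le>o |?U|"
      using card_of_Field_ordIso[OF Card_r] ordIso_symmetric ordIso_ordLeq_trans by blast
    with \<open>|?U| <o r\<close> show False using not_ordLess_ordLeq by blast
  qed
  then obtain y where y: "y \<in> Field r" "y \<notin> ?U" by blast
  have "ltw r s y" if "s \<in> S" for s
  proof (rule ccontr)
    assume "\<not> ltw r s y"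
    then have "(y, s) \<in> r" using not_ltw[OF wo_r _ y(1)] that assms(1) by blast
    then show False using y(2) that unfolding underS_def by blast
  qed
  then show ?thesis using y(1) by blast
qed

lemma image_bounded:
  assumes "|W| \<le>o |X|" "\<And>w. w \<in> W \<Longrightarrow> f w \<in> Field r"
  shows "\<exists>y\<in>Field r. \<forall>w\<in>W. ltw r (f w) y"
proof -
  have "f ` W \<subseteq> Field r" using assms(2) by blast
  from small_bounded[OF this ordLeq_transitive[OF card_of_image assms(1)]]
  show ?thesis by blast
qed

text \<open>This replaces the intersection of |X| clubs: by \<open>closure_points_antimono\<close>,
  the closure points of \<open>F\<close> are closure points of every \<open>G w\<close>.\<close>

lemma family_dominated:
  assumes "|W| \<le>o |X|" "\<And>w u. w \<in> W \<Longrightarrow> u \<in> Field r \<Longrightarrow> G w u \<in> Field r"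
  shows "\<exists>F. \<forall>u\<in>Field r. F u \<in> Field r \<and> (\<forall>w\<in>W. ltw r (G w u) (F u))"
proof -
  have "\<exists>y. y \<in> Field r \<and> (\<forall>w\<in>W. ltw r (G w u) y)" if "u \<in> Field r" for u
    using image_bounded[OF assms(1), of "\<lambda>w. G w u"] assms(2) that by blast
  then show ?thesis by metis
qed

lemma closure_points_antimono:
  assumes "\<And>u. u \<in> Field r \<Longrightarrow> ltw r (G u) (F u)"
  shows "closure_points r F \<subseteq> closure_points r G"
proof
  fix e assume e: "e \<in> closure_points r F"
  have "ltw r (G u) e" if u: "ltw r u e" for u
    using ltw_trans[OF wo_r assms[OF ltw_Field(1)[OF u]]] e u unfolding closure_points_def by simp
  then show "e \<in> closure_points r G" using e unfolding closure_points_def by simp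
qed

lemma closure_points_unbounded:
  assumes F: "\<And>u. u \<in> Field r \<Longrightarrow> F u \<in> Field r" and x: "x \<in> Field r"
  shows "\<exists>e\<in>closure_points r F. ltw r x e"
proof -
  \<comment> \<open>One closing-off step: \<open>y\<close> lies above \<open>z\<close> and above all
    values of \<open>F\<close> below \<open>z\<close>. The supremum \<open>e\<close> of its iterates
    from \<open>x\<close> is then a closure point, and \<open>x\<close> witnesses that it is not the
    least element.\<close>
  have step: "\<exists>y. y \<in> Field r \<and> ltw r z y \<and> (\<forall>u. ltw r u z \<longrightarrow> ltw r (F u) y)" if z: "z \<in> Field r" for z
  proof -
    have "F u \<in> Field r" if "u \<in> underS r z" for u
      using F that ltw_Field(1) unfolding underS_iff_ltw by metis
    from image_bounded[OF underS_le_X[OF z], of F, OF this] obtain y1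
      where y1: "y1 \<in> Field r" "\<forall>u\<in>underS r z. ltw r (F u) y1" by blast
    obtain y where y: "y \<in> Field r" "ltw r z y" "ltw r y1 y"
      using small_bounded[of "{z, y1}"] z y1(1)
        ordLess_imp_ordLeq[OF finite_ordLess_infinite_set[OF _ inf_X], of "{z, y1}"] by blast
    have "ltw r (F u) y" if "ltw r u z" for u
      using y1(2) that ltw_trans[OF wo_r _ y(3)] by (simp add: underS_iff_ltw)
    with y show ?thesis by blast
  qed
  then obtain nx where nx: "\<And>z. z \<in> Field r \<Longrightarrow> nx z \<in> Field r"
    "\<And>z. z \<in> Field r \<Longrightarrow> ltw r z (nx z)"
    "\<And>z u. z \<in> Field r \<Longrightarrow> ltw r u z \<Longrightarrow> ltw r (F u) (nx z)"
    by metis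
  define s where "s n = (nx ^^ n) x" for n
  have s: "s n \<in> Field r" for n unfolding s_def by (induction n) (auto simp: x nx(1))
  have s_Suc: "s (Suc n) = nx (s n)" for n by (simp add: s_def)
  have "|UNIV :: nat set| \<le>o |X|" using inf_X infinite_iff_card_of_nat by blast
  from image_bounded[OF this, of s] s obtain y where "y \<in> Field r" "\<forall>n. ltw r (s n) y" by blast
  then obtain e where e: "e \<in> Field r" "\<And>n. ltw r (s n) e"
    and min: "\<And>z. z \<in> Field r \<Longrightarrow> (\<forall>n. ltw r (s n) z) \<Longrightarrow> (e, z) \<in> r"
    using Well_order_least[OF wo_r, of y "\<lambda>z. \<forall>n. ltw r (s n) z"] by blast
  have "ltw r (F u) e" if u: "ltw r u e" for u
  proof -
    have uF: "u \<in> Field r" using u by (rule ltw_Field)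
    have "\<not> (\<forall>n. ltw r (s n) u)" using min[OF uF] ltw_asym[OF wo_r u] by blast
    then obtain n where "(u, s n) \<in> r" using not_ltw[OF wo_r s uF] by blast
    then have "ltw r u (s (Suc n))" using le_ltw_trans[OF wo_r] nx(2)[OF s] s_Suc by metis
    then have "ltw r (F u) (s (Suc (Suc n)))" using nx(3)[OF s] s_Suc by metis
    then show ?thesis using e(2) ltw_trans[OF wo_r] by blast
  qed
  moreover have "ltw r x e" using e(2)[of 0] by (simp add: s_def)
  ultimately show ?thesis using e(1) unfolding closure_points_def by blast
qed

lemma ex_bottom: "\<exists>z\<in>Field r. \<forall>x\<in>Field r. (z, x) \<in> r"
proof -
  obtain x where "x \<in> Field r" using small_bounded[of "{}"] card_of_empty by blast
  then show ?thesis using Well_order_least[OF wo_r, of x "\<lambda>_. True"] by simp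
qed

text \<open>Ulam matrix: \<open>h e\<close> injects the predecessors of \<open>e\<close> into \<open>X\<close>. For every \<open>g\<close>
  some value \<open>v g\<close> makes \<open>{e. h e g = v g}\<close> stationary, and some \<open>x\<close> is \<open>v g\<close>
  for as many \<open>g\<close> as there are elements of \<open>X\<close>.\<close>

lemma stationary_partition:
  "\<exists>T :: 'b \<Rightarrow> 'c. \<forall>F. (\<forall>u\<in>Field r. F u \<in> Field r) \<longrightarrow> (\<forall>c\<in>X. \<exists>e\<in>closure_points r F. T e = c)"
proof -
  have "\<forall>e\<in>Field r. \<exists>h. inj_on h (underS r e) \<and> h ` underS r e \<subseteq> X"
    using underS_le_X card_of_ordLeq by blast
  then obtain h where h: "\<And>e. e \<in> Field r \<Longrightarrow> inj_on (h e) (underS r e)"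
    "\<And>e. e \<in> Field r \<Longrightarrow> h e ` underS r e \<subseteq> X" by metis
  define stat where "stat S \<longleftrightarrow>
    (\<forall>F. (\<forall>u\<in>Field r. F u \<in> Field r) \<longrightarrow> closure_points r F \<inter> S \<noteq> {})" for S
  \<comment> \<open>Otherwise each fibre misses the closure points of some \<open>G x\<close>. A
    closure point \<open>e\<close> of a common bound \<open>F\<close> above \<open>g\<close> lies in
    the fibre of its own value \<open>h e g\<close>, a contradiction.\<close>
  have "\<exists>x\<in>X. stat {e. ltw r g e \<and> h e g = x}" if g: "g \<in> Field r" for g
  proof (rule ccontr)
    assume "\<not> ?thesis"
    then obtain G where G: "\<And>x u. x \<in> X \<Longrightarrow> u \<in> Field r \<Longrightarrow> G x u \<in> Field r"
      "\<And>x. x \<in> X \<Longrightarrow> closure_points r (G x) \<inter> {e. ltw r g e \<and> h e g = x} = {}"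
      unfolding stat_def by metis
    obtain F where F: "\<And>u. u \<in> Field r \<Longrightarrow> F u \<in> Field r"
      "\<And>x u. x \<in> X \<Longrightarrow> u \<in> Field r \<Longrightarrow> ltw r (G x u) (F u)"
      using family_dominated[OF card_of_ordLeq_refl, of G] G(1) by metis
    obtain e where e: "e \<in> closure_points r F" "ltw r g e"
      using closure_points_unbounded[of F, OF _ g] F(1) by blast
    have x: "h e g \<in> X"
      using h(2)[of e] e(2) ltw_Field unfolding underS_iff_ltw[symmetric] by fast
    have "e \<in> closure_points r (G (h e g))" using closure_points_antimono F(2)[OF x] e(1) by blast
    then show False using G(2)[OF x] e(2) by blast
  qed
  then obtain v where v: "\<And>g. g \<in> Field r \<Longrightarrow> v g \<in> X"
    "\<And>g. g \<in> Field r \<Longrightarrow> stat {e. ltw r g e \<and> h e g = v g}" by metis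
  have "\<exists>x\<in>X. |X| \<le>o |{g \<in> Field r. v g = x}|"
  proof (rule ccontr)
    assume "\<not> ?thesis"
    then have "|{g \<in> Field r. v g = x}| \<le>o |X|" if "x \<in> X" for x
      using ordLess_imp_ordLeq[OF not_card_of_ordLeq] that by blast
    then have "|\<Union>x\<in>X. {g \<in> Field r. v g = x}| \<le>o |X|"
      by (intro card_of_UNION_ordLeq_infinite[OF inf_X card_of_ordLeq_refl] ballI)
    moreover have "(\<Union>x\<in>X. {g \<in> Field r. v g = x}) = Field r" using v(1) by blast
    ultimately have "|Field r| \<le>o |X|" by simp
    then have "r \<le>o |X|"
      by (rule ordIso_ordLeq_trans[OF ordIso_symmetric[OF card_of_Field_ordIso[OF Card_r]]])
    then show False using not_ordLess_ordLeq[OF X_less] by contradiction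
  qed
  then obtain x where x: "x \<in> X" "|X| \<le>o |{g \<in> Field r. v g = x}|" by blast
  have "X \<noteq> {}" using inf_X by auto
  then obtain q where q: "q ` {g \<in> Field r. v g = x} = X"
    using card_of_ordLeq2 x(2) by metis
  \<comment> \<open>Since \<open>h e\<close> is injective, at most one \<open>g\<close> qualifies
    for a given \<open>e\<close>: the stationary sets for distinct \<open>g\<close> are disjoint.
    The map \<open>q\<close> relabels them by the elements of \<open>X\<close>.\<close>
  define T where "T e = q (SOME g. g \<in> Field r \<and> v g = x \<and> ltw r g e \<and> h e g = x)" for e
  have "\<exists>e\<in>closure_points r F. T e = c" if F: "\<forall>u\<in>Field r. F u \<in> Field r" and c: "c \<in> X" for F c
  proof -
    obtain g where g: "g \<in> Field r" "v g = x" "q g = c" using q c by blast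
    obtain e where e: "e \<in> closure_points r F" "ltw r g e" "h e g = x"
      using v(2)[OF g(1)] F g(2) unfolding stat_def by blast
    have "(SOME g. g \<in> Field r \<and> v g = x \<and> ltw r g e \<and> h e g = x) = g"
    proof (rule some_equality)
      fix g' assume "g' \<in> Field r \<and> v g' = x \<and> ltw r g' e \<and> h e g' = x"
      then show "g' = g"
        using inj_onD[OF h(1)[OF ltw_Field(2)[OF e(2)]], of g' g] e by (simp add: underS_iff_ltw)
    qed (use g e in auto)
    then show ?thesis using e(1) g(3) unfolding T_def by auto
  qed
  then show ?thesis by blast
qed

end

section \<open>The successor of a strong limit cardinal\<close>

lemma card_of_Pow_mono:
  assumes "|A| \<le>o |B|"
  shows "|Pow A| \<le>o |Pow B|"
proof -
  obtain f where f: "inj_on f A" "f ` A \<subseteq> B" using assms card_of_ordLeq by metis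
  have "inj_on (image f) (Pow A)" using f(1) by (rule inj_on_image_Pow)
  moreover have "image f ` Pow A \<subseteq> Pow B" using f(2) by auto
  ultimately show ?thesis using card_of_ordLeq by metis
qed

locale strong_limit_succ =
  fixes m k :: "'a rel"
  assumes Card_m: "Card_order m"
    and uncountable_m: "|UNIV :: nat set| <o m"
    and strong_limit_m: "\<And>Y :: 'a set. |Y| <o m \<Longrightarrow> |Pow Y| <o m"
    and Card_k: "Card_order k"
    and k_succ: "k =o cardSuc m"
    and Pow_m: "|Pow (Field m)| \<le>o k"
begin

lemma wo_m: "Well_order m" and wo_k: "Well_order k"
  using Card_m Card_k by (auto intro: Card_order_Well_order)

lemma Field_m: "|Field m| =o m" and Field_k: "|Field k| =o k"
  using Card_m Card_k by (auto intro: card_of_Field_ordIso)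

lemma inf_m: "infinite (Field m)"
proof
  assume "finite (Field m)"
  then have "|Field m| <o |UNIV :: nat set|" by (rule finite_ordLess_infinite_set) simp
  then have "m <o |UNIV :: nat set|" by (rule ordIso_ordLess_trans[OF ordIso_symmetric[OF Field_m]])
  then show False using ordLess_transitive[OF uncountable_m] ordLess_irreflexive by metis
qed

lemma ordLeq_Field_m: "|Y| \<le>o m \<longleftrightarrow> |Y| \<le>o |Field m|"
  using ordLeq_ordIso_trans[OF _ Field_m] ordLeq_ordIso_trans[OF _ ordIso_symmetric[OF Field_m]] by auto

text \<open>The locale assumption covers sets of one type only; a set of any type of size below
  \<open>m\<close> is equinumerous with such a set.\<close>

lemma strong_limit:
  assumes "|Y| <o m"
  shows "|Pow Y| <o m"
proof -
  obtain B :: "'a set" where B: "|Y| =o |B|" "|B| <o m"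
    using iffD1[OF internalize_card_of_ordLess assms] by blast
  have "|Pow Y| \<le>o |Pow B|" by (rule card_of_Pow_mono[OF ordIso_imp_ordLeq[OF B(1)]])
  then show ?thesis using strong_limit_m[OF B(2)] by (rule ordLeq_ordLess_trans)
qed

lemma Times_less_m: "|A| <o m \<Longrightarrow> |B| <o m \<Longrightarrow> |A \<times> B| <o m"
proof -
  assume A: "|A| <o m" and B: "|B| <o m"
  \<comment> \<open>The summand of natural numbers makes the bound infinite even when
    \<open>A\<close> and \<open>B\<close> are finite, so that it absorbs products.\<close>
  let ?C = "A <+> (B <+> (UNIV :: nat set))"
  have inf: "infinite ?C" by simp
  have "|?C| <o m"
    by (intro card_of_Plus_ordLess_infinite_Field[OF inf_m Card_m] A B uncountable_m)
  moreover have "|A \<times> B| \<le>o |?C|"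
  proof (rule card_of_Sigma_ordLeq_infinite[OF inf])
    show "|A| \<le>o |?C|" by (rule card_of_Plus1)
    have "|B| \<le>o |?C|" by (rule ordLeq_transitive[OF card_of_Plus1 card_of_Plus2])
    then show "\<forall>i\<in>A. |B| \<le>o |?C|" by blast
  qed
  ultimately show ?thesis by (rule ordLeq_ordLess_trans[rotated])
qed

lemma Pow_le_k: "|Y| \<le>o m \<Longrightarrow> |Pow Y| \<le>o k"
  unfolding ordLeq_Field_m by (rule ordLeq_transitive[OF card_of_Pow_mono Pow_m])

sublocale succ_k: succ_card k "Field m"
proof
  have "cardSuc m =o cardSuc |Field m|"
    by (rule iffD2[OF cardSuc_invar_ordIso[OF Card_m card_of_Card_order] ordIso_symmetric[OF Field_m]])
  then show "k =o cardSuc |Field m|" by (rule ordIso_transitive[OF k_succ])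
qed (auto simp: Card_k inf_m)

text \<open>The levels are the infinite cardinals below \<open>m\<close>, given as initial ordinals: level \<open>i\<close>
  has cardinality that of \<open>underS m i\<close>, and \<open>L i\<close> is its successor cardinal.\<close>

definition levels :: "'a set" where
  "levels = {i \<in> Field m. infinite (underS m i) \<and> (\<forall>j. ltw m j i \<longrightarrow> |underS m j| <o |underS m i| )}"

definition L :: "'a \<Rightarrow> 'a set rel" where
  "L i = cardSuc |underS m i|"

lemma levels_Field: "i \<in> levels \<Longrightarrow> i \<in> Field m"
  unfolding levels_def by simp

lemma succ_card_L: "i \<in> levels \<Longrightarrow> succ_card (L i) (underS m i)"
  unfolding levels_def L_def
  by unfold_locales
    (auto intro: cardSuc_Card_order card_of_Card_order ordIso_refl)

lemma wo_L: "i \<in> levels \<Longrightarrow> Well_order (L i)"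
  using succ_card.wo_r[OF succ_card_L] .

lemma L_le_Pow: "|Field (L i)| \<le>o |Pow (underS m i)|"
proof -
  have "L i \<le>o |Pow (underS m i)|"
    unfolding L_def by (rule cardSuc_least[OF card_of_Card_order card_of_Card_order card_of_Pow])
  moreover have "|Field (L i)| =o L i"
    unfolding L_def by (rule card_of_Field_ordIso[OF cardSuc_Card_order[OF card_of_Card_order]])
  ultimately show ?thesis by (rule ordIso_ordLeq_trans[rotated])
qed

lemma L_less_m: "i \<in> Field m \<Longrightarrow> |Field (L i)| <o m"
  using ordLeq_ordLess_trans[OF L_le_Pow strong_limit[OF card_of_underS[OF Card_m]]] .

text \<open>This gap between levels lets one element of \<open>L j\<close> bound contributions
  indexed by the elements of all lower \<open>L i\<close>.\<close>

lemma L_le_level: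
  assumes "i \<in> levels" "j \<in> levels" "ltw m i j"
  shows "|Field (L i)| \<le>o |underS m j|"
proof -
  have "|underS m i| <o |underS m j|" using assms unfolding levels_def by blast
  then have "L i \<le>o |underS m j|"
    unfolding L_def by (rule cardSuc_least[OF card_of_Card_order card_of_Card_order])
  moreover have "|Field (L i)| =o L i"
    unfolding L_def by (rule card_of_Field_ordIso[OF cardSuc_Card_order[OF card_of_Card_order]])
  ultimately show ?thesis by (rule ordIso_ordLeq_trans[rotated])
qed

lemma underS_m_mono: "(i, j) \<in> m \<Longrightarrow> |underS m i| \<le>o |underS m j|"
  by (rule card_of_mono1) (use ltw_le_trans[OF wo_m] underS_iff_ltw in \<open>metis subsetI\<close>)

lemma levels_cofinal:
  fixes Y :: "'b set"
  assumes Y: "|Y| <o m" and c: "c \<in> Field m"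
  shows "\<exists>i\<in>levels. ltw m c i \<and> |Y| \<le>o |underS m i|"
proof -
  \<comment> \<open>\<open>i\<close> will be the least index with more than |Z| predecessors, which
    exists because \<open>m\<close> is a strong limit. Minimality puts it in \<open>levels\<close>,
    and the three summands give |Y| below it, \<open>c\<close> below it, and infinity.\<close>
  let ?Z = "Y <+> (underS m c <+> (UNIV :: nat set))"
  have Zm: "|?Z| <o m"
    by (intro card_of_Plus_ordLess_infinite_Field[OF inf_m Card_m] Y card_of_underS[OF Card_m c] uncountable_m)
  then obtain d where d: "d \<in> Field m" "|Pow ?Z| =o Restr m (underS m d)"
    using iffD1[OF ordLess_iff_ordIso_Restr[OF wo_m card_of_Well_order] strong_limit[OF Zm]]
    by (elim bexE)
  have "|Pow ?Z| =o |Field (Restr m (underS m d))|"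
    using card_of_cong[OF d(2)] by (simp add: Field_card_of)
  then have "|Pow ?Z| \<le>o |underS m d|"
    by (rule ordIso_ordLeq_trans) (rule card_of_mono1, auto simp: Field_def)
  then have Zd: "|?Z| <o |underS m d|" by (rule ordLess_ordLeq_trans[OF card_of_Pow])
  then obtain i where i: "i \<in> Field m" "|?Z| <o |underS m i|"
    and min: "\<And>j. j \<in> Field m \<Longrightarrow> |?Z| <o |underS m j| \<Longrightarrow> (i, j) \<in> m"
    using Well_order_least[OF wo_m d(1), of "\<lambda>i. |?Z| <o |underS m i|"] by metis
  have "infinite (underS m i)"
    using card_of_ordLeq_infinite[OF ordLess_imp_ordLeq[OF i(2)]] by simp
  moreover have "|underS m j| <o |underS m i|" if j: "ltw m j i" for j
  proof -
    have "\<not> |?Z| <o |underS m j|" using min[OF ltw_Field(1)[OF j]] ltw_asym[OF wo_m j] by blast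
    then have "|underS m j| \<le>o |?Z|" using not_card_of_ordLeq by metis
    then show ?thesis using i(2) by (rule ordLeq_ordLess_trans)
  qed
  ultimately have "i \<in> levels" unfolding levels_def using i(1) by blast
  moreover have "ltw m c i"
  proof (rule ccontr)
    assume "\<not> ltw m c i"
    then have "|underS m i| \<le>o |underS m c|" by (rule underS_m_mono[OF not_ltw[OF wo_m c i(1)]])
    also have "|underS m c| \<le>o |?Z|" by (rule ordLeq_transitive[OF card_of_Plus1 card_of_Plus2])
    finally show False using not_ordLess_ordLeq[OF i(2)] by contradiction
  qed
  moreover have "|Y| \<le>o |underS m i|"
    by (rule ordLeq_transitive[OF card_of_Plus1 ordLess_imp_ordLeq[OF i(2)]])
  ultimately show ?thesis by blast
qed

text \<open>If no bound existed, the image of \<open>g\<close> would be cofinal in \<open>m\<close>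
  with at most |X| elements.\<close>

lemma less_cf_bounded:
  assumes "less_cf X m" "\<And>x. x \<in> X \<Longrightarrow> g x \<in> Field m"
  shows "\<exists>c\<in>Field m. \<forall>x\<in>X. (g x, c) \<in> m"
proof (rule ccontr)
  assume *: "\<not> ?thesis"
  have "cofinal (g ` X) m"
    unfolding cofinal_def
  proof
    fix c assume c: "c \<in> Field m"
    then obtain x where x: "x \<in> X" "(g x, c) \<notin> m" using * by blast
    then have "ltw m c (g x)" using not_ltw[OF wo_m c assms(2)[OF x(1)]] by blast
    then show "\<exists>b\<in>g ` X. c \<noteq> b \<and> (c, b) \<in> m" using x(1) unfolding ltw_def by blast
  qed
  then have "|X| <o |g ` X|" using assms unfolding less_cf_def by blast
  then show False using card_of_image[of g X] not_ordLess_ordLeq by metis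
qed

lemma less_cf_less: "less_cf X m \<Longrightarrow> |X| <o m"
proof -
  assume "less_cf X m"
  moreover have "cofinal (Field m) m"
    unfolding cofinal_def using infinite_Card_order_limit[OF Card_m inf_m] by blast
  ultimately have "|X| <o |Field m|" unfolding less_cf_def by blast
  then show ?thesis using Field_m by (rule ordLess_ordIso_trans)
qed

lemma less_cf_mono: "less_cf X m \<Longrightarrow> |Y| \<le>o |X| \<Longrightarrow> less_cf Y m"
  unfolding less_cf_def using ordLeq_ordLess_trans by metis

lemma upper_bound2:
  assumes "c \<in> Field m" "d \<in> Field m"
  shows "\<exists>e\<in>Field m. (c, e) \<in> m \<and> (d, e) \<in> m"
  using not_ltw[OF wo_m assms] ltw_imp_le[of m c d] Well_order_refl[OF wo_m] assms by metis

section \<open>Sequences of functions along the levels\<close>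

lemma enumerate_functions:
  "\<exists>Phi :: 'a \<Rightarrow> 'a \<Rightarrow> 'a set \<Rightarrow> 'a set.
     (\<forall>g. \<forall>i. \<forall>u\<in>Field (L i). Phi g i u \<in> Field (L i)) \<and>
     (\<forall>G. (\<forall>i\<in>levels. \<forall>u\<in>Field (L i). G i u \<in> Field (L i)) \<longrightarrow>
        (\<exists>g\<in>Field k. \<forall>i\<in>levels. \<forall>u\<in>Field (L i). Phi g i u = G i u))"
proof -
  \<comment> \<open>The graph of a sequence of functions is a subset of this set of size at most
    \<mu>, and \<open>k\<close> has enough elements to list all its subsets.\<close>
  let ?S = "SIGMA i:levels. Field (L i) \<times> Field (L i)"
  have "|levels| \<le>o m"
    unfolding ordLeq_Field_m by (rule card_of_mono1) (auto simp: levels_def)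
  then have "|?S| \<le>o m"
  proof (rule card_of_Sigma_ordLeq_infinite_Field[OF inf_m Card_m], intro ballI)
    fix i assume "i \<in> levels"
    then show "|Field (L i) \<times> Field (L i)| \<le>o m"
      by (intro ordLess_imp_ordLeq Times_less_m L_less_m levels_Field)
  qed
  then have "|Pow ?S| \<le>o |Field k|"
    by (rule ordLeq_ordIso_trans[OF Pow_le_k ordIso_symmetric[OF Field_k]])
  then have "\<exists>en. en ` Field k = Pow ?S" by (rule iffD2[OF card_of_ordLeq2, rotated]) blast
  then obtain en where en: "en ` Field k = Pow ?S" ..
  \<comment> \<open>The default \<open>u\<close> keeps \<open>Phi g i\<close> a map of
    \<open>L i\<close> into itself even when \<open>en g\<close> is not the graph of a
    function.\<close>
  define Phi where "Phi g i u =
    (if \<exists>v\<in>Field (L i). (i, u, v) \<in> en g then SOME v. v \<in> Field (L i) \<and> (i, u, v) \<in> en g else u)" for g i u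
  have "Phi g i u \<in> Field (L i)" if "u \<in> Field (L i)" for g i u
  proof (cases "\<exists>v. v \<in> Field (L i) \<and> (i, u, v) \<in> en g")
    case True
    from someI_ex[OF this] True show ?thesis unfolding Phi_def by auto
  qed (use that in \<open>auto simp: Phi_def\<close>)
  moreover have "\<exists>g\<in>Field k. \<forall>i\<in>levels. \<forall>u\<in>Field (L i). Phi g i u = G i u"
    if G: "\<forall>i\<in>levels. \<forall>u\<in>Field (L i). G i u \<in> Field (L i)" for G
  proof -
    have "{(i, u, v). i \<in> levels \<and> u \<in> Field (L i) \<and> v = G i u} \<in> Pow ?S" using G by auto
    then obtain g where g: "g \<in> Field k" "en g = {(i, u, v). i \<in> levels \<and> u \<in> Field (L i) \<and> v = G i u}"
      using en by (metis (no_types, lifting) imageE)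
    have "Phi g i u = G i u" if "i \<in> levels" "u \<in> Field (L i)" for i u
      unfolding Phi_def g(2) using that G by (auto intro!: some_equality)
    then show ?thesis using g(1) by blast
  qed
  ultimately show ?thesis by (intro exI[of _ Phi]) blast
qed

lemma underS_k_inj:
  "\<exists>code. \<forall>b\<in>Field k. inj_on (code b) (underS k b) \<and> code b ` underS k b \<subseteq> Field m"
proof -
  have "\<exists>h. inj_on h (underS k b) \<and> h ` underS k b \<subseteq> Field m" if "b \<in> Field k" for b
    using succ_k.underS_le_X[OF that] card_of_ordLeq by metis
  then show ?thesis by metis
qed

text \<open>\<open>B b\<close> eventually dominates the \<open>g\<close>-th sequence of functions for every \<open>g\<close> below \<open>b\<close>: the set
  of these \<open>g\<close> is a union, over the levels \<open>i\<close>, of increasing sets too small to be unbounded in \<open>L i\<close>.\<close>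

lemma scale_exists:
  "\<exists>B :: 'a \<Rightarrow> 'a \<Rightarrow> 'a set \<Rightarrow> 'a set.
     (\<forall>b\<in>Field k. \<forall>i\<in>levels. \<forall>u\<in>Field (L i). B b i u \<in> Field (L i)) \<and>
     (\<forall>G. (\<forall>i\<in>levels. \<forall>u\<in>Field (L i). G i u \<in> Field (L i)) \<longrightarrow>
        (\<exists>g\<in>Field k. \<forall>b. ltw k g b \<longrightarrow> (\<exists>c\<in>Field m. \<forall>i\<in>levels. ltw m c i \<longrightarrow>
           (\<forall>u\<in>Field (L i). ltw (L i) (G i u) (B b i u)))))"
proof -
  obtain Phi :: "'a \<Rightarrow> 'a \<Rightarrow> 'a set \<Rightarrow> 'a set"
    where Phi: "\<And>g i u. u \<in> Field (L i) \<Longrightarrow> Phi g i u \<in> Field (L i)"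
      "\<And>G. \<forall>i\<in>levels. \<forall>u\<in>Field (L i). G i u \<in> Field (L i) \<Longrightarrow>
        \<exists>g\<in>Field k. \<forall>i\<in>levels. \<forall>u\<in>Field (L i). Phi g i u = G i u"
    using enumerate_functions by metis
  obtain code where code: "\<And>b. b \<in> Field k \<Longrightarrow> inj_on (code b) (underS k b)"
    "\<And>b. b \<in> Field k \<Longrightarrow> code b ` underS k b \<subseteq> Field m"
    using underS_k_inj by metis
  \<comment> \<open>Each \<open>g\<close> below \<open>b\<close> enters \<open>W b i\<close> once
    \<open>i\<close> passes its code, so \<open>code b g\<close> is the threshold beyond which
    \<open>B b\<close> dominates sequence \<open>g\<close>.\<close>
  define W where "W b i = {g \<in> underS k b. ltw m (code b g) i}" for b i
  have "\<exists>F. \<forall>u\<in>Field (L i). F u \<in> Field (L i) \<and> (\<forall>g\<in>W b i. ltw (L i) (Phi g i u) (F u))"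
    if b: "b \<in> Field k" and i: "i \<in> levels" for b i
  proof (rule succ_card.family_dominated[OF succ_card_L[OF i]])
    have "inj_on (code b) (W b i)" using code(1)[OF b] by (rule inj_on_subset) (auto simp: W_def)
    moreover have "code b ` W b i \<subseteq> underS m i" by (auto simp: W_def underS_iff_ltw)
    ultimately show "|W b i| \<le>o |underS m i|" using card_of_ordLeq by metis
  qed (rule Phi(1))
  then obtain B where B: "\<And>b i u. b \<in> Field k \<Longrightarrow> i \<in> levels \<Longrightarrow> u \<in> Field (L i) \<Longrightarrow> B b i u \<in> Field (L i)"
    "\<And>b i u g. b \<in> Field k \<Longrightarrow> i \<in> levels \<Longrightarrow> u \<in> Field (L i) \<Longrightarrow> g \<in> W b i \<Longrightarrow>
      ltw (L i) (Phi g i u) (B b i u)" by metis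
  have "\<exists>g\<in>Field k. \<forall>b. ltw k g b \<longrightarrow> (\<exists>c\<in>Field m. \<forall>i\<in>levels. ltw m c i \<longrightarrow>
           (\<forall>u\<in>Field (L i). ltw (L i) (G i u) (B b i u)))"
    if G: "\<forall>i\<in>levels. \<forall>u\<in>Field (L i). G i u \<in> Field (L i)" for G
  proof -
    obtain g where g: "g \<in> Field k" "\<And>i u. i \<in> levels \<Longrightarrow> u \<in> Field (L i) \<Longrightarrow> Phi g i u = G i u"
      using Phi(2)[OF G] by blast
    have "code b g \<in> Field m \<and> (\<forall>i\<in>levels. ltw m (code b g) i \<longrightarrow>
        (\<forall>u\<in>Field (L i). ltw (L i) (G i u) (B b i u)))" if gb: "ltw k g b" for b
    proof -
      have b: "b \<in> Field k" using gb by (rule ltw_Field)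
      have "code b g \<in> Field m" using code(2)[OF b] gb by (auto simp: underS_iff_ltw)
      moreover have "g \<in> W b i" if "ltw m (code b g) i" for i
        using that gb by (simp add: W_def underS_iff_ltw)
      ultimately show ?thesis using B(2)[OF b] g(2) by metis
    qed
    then show ?thesis using g(1) by blast
  qed
  then show ?thesis using B(1) by (intro exI[of _ B]) blast
qed

section \<open>Colourings constant on products\<close>

text \<open>Disjoint families of size \<mu>^+ have this property, and it survives the pigeonhole
  arguments that shrink the family.\<close>

definition k_unbounded :: "'a set set \<Rightarrow> bool" where
  "k_unbounded A \<longleftrightarrow> (\<forall>g\<in>Field k. \<exists>a\<in>A. \<forall>\<alpha>\<in>a. ltw k g \<alpha>)"

text \<open>Fewer than cf(\<mu>) thresholds have a common upper bound in \<open>m\<close>.\<close>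

lemma eventually_all:
  assumes "less_cf X m" "\<And>x. x \<in> X \<Longrightarrow> \<exists>c\<in>Field m. \<forall>i\<in>levels. ltw m c i \<longrightarrow> P x i"
  shows "\<exists>c\<in>Field m. \<forall>i\<in>levels. ltw m c i \<longrightarrow> (\<forall>x\<in>X. P x i)"
proof -
  obtain g where g: "\<And>x. x \<in> X \<Longrightarrow> g x \<in> Field m"
    "\<And>x i. x \<in> X \<Longrightarrow> i \<in> levels \<Longrightarrow> ltw m (g x) i \<Longrightarrow> P x i" using assms(2) by metis
  obtain c where "c \<in> Field m" "\<forall>x\<in>X. (g x, c) \<in> m"
    using less_cf_bounded[of X g, OF assms(1) g(1)] by blast
  then show ?thesis using g(2) le_ltw_trans[OF wo_m] by metis
qed

text \<open>The colour of \<open>\<alpha>, \<beta>\<close> is read off at the last level \<open>i\<close> with \<open>f \<beta> i < f \<alpha> i\<close>, where it is the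
  stationary class of the largest closure point of \<open>B \<beta> i\<close> below \<open>f \<alpha> i\<close>. Given \<open>A\<close>, pick
  \<open>aa i u \<in> A\<close> with all \<open>f \<alpha> i\<close> above \<open>u\<close>, and let \<open>H i u\<close> bound the \<open>i\<close>-th coordinates of \<open>aa i u\<close> and
  of all \<open>aa j w\<close> with \<open>j\<close> below \<open>i\<close>. If \<open>b\<close> lies above the index of \<open>H\<close> and \<open>e\<close> is a common closure
  point of colour \<open>\<gamma>\<close>, then all pairs in \<open>aa i e \<times> b\<close> get colour \<open>\<gamma>\<close>.\<close>

lemma constant_colours:
  "\<exists>col :: 'a \<Rightarrow> 'a \<Rightarrow> 'a. \<forall>(X :: 'b set) A \<gamma>.
     less_cf X m \<longrightarrow> (\<forall>a\<in>A. a \<subseteq> Field k \<and> |a| \<le>o |X| ) \<longrightarrow> k_unbounded A \<longrightarrow> \<gamma> \<in> Field m \<longrightarrow>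
     (\<exists>a\<in>A. \<exists>b\<in>A. \<forall>\<alpha>\<in>a. \<forall>\<beta>\<in>b. ltw k \<alpha> \<beta> \<and> col \<alpha> \<beta> = \<gamma>)"
proof -
  obtain B :: "'a \<Rightarrow> 'a \<Rightarrow> 'a set \<Rightarrow> 'a set" where
    B: "\<And>b i u. b \<in> Field k \<Longrightarrow> i \<in> levels \<Longrightarrow> u \<in> Field (L i) \<Longrightarrow> B b i u \<in> Field (L i)"
    and B_dom: "\<And>G. \<forall>i\<in>levels. \<forall>u\<in>Field (L i). G i u \<in> Field (L i) \<Longrightarrow>
        \<exists>g\<in>Field k. \<forall>b. ltw k g b \<longrightarrow> (\<exists>c\<in>Field m. \<forall>i\<in>levels. ltw m c i \<longrightarrow>
           (\<forall>u\<in>Field (L i). ltw (L i) (G i u) (B b i u)))"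
    using scale_exists by metis
  have "\<forall>i\<in>levels. \<exists>T. \<forall>F. (\<forall>u\<in>Field (L i). F u \<in> Field (L i)) \<longrightarrow>
      (\<forall>c\<in>underS m i. \<exists>e\<in>closure_points (L i) F. T e = c)"
    using succ_card.stationary_partition[OF succ_card_L] by blast
  then obtain T where T: "\<And>i F c. i \<in> levels \<Longrightarrow> (\<forall>u\<in>Field (L i). F u \<in> Field (L i)) \<Longrightarrow>
      c \<in> underS m i \<Longrightarrow> \<exists>e\<in>closure_points (L i) F. T i e = c" by metis
  have "\<forall>i\<in>levels. \<exists>z\<in>Field (L i). \<forall>x\<in>Field (L i). (z, x) \<in> L i"
    using succ_card.ex_bottom[OF succ_card_L] by blast
  then obtain bot where bot: "\<And>i. i \<in> levels \<Longrightarrow> bot i \<in> Field (L i)"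
    "\<And>i x. i \<in> levels \<Longrightarrow> x \<in> Field (L i) \<Longrightarrow> (bot i, x) \<in> L i" by metis
  define f where "f b i = B b i (bot i)" for b i
  have f: "f b i \<in> Field (L i)" if "b \<in> Field k" "i \<in> levels" for b i
    unfolding f_def using B bot(1) that by blast
  define lev where "lev \<alpha> \<beta> i \<longleftrightarrow> i \<in> levels \<and> ltw (L i) (f \<beta> i) (f \<alpha> i) \<and>
    (\<forall>j\<in>levels. ltw m i j \<longrightarrow> ltw (L j) (f \<alpha> j) (f \<beta> j))" for \<alpha> \<beta> i
  define proj where "proj \<alpha> \<beta> i e \<longleftrightarrow> e \<in> closure_points (L i) (B \<beta> i) \<and> (e, f \<alpha> i) \<in> L i \<and>
    (\<forall>z\<in>closure_points (L i) (B \<beta> i). (z, f \<alpha> i) \<in> L i \<longrightarrow> (z, e) \<in> L i)" for \<alpha> \<beta> i e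
  define col where "col \<alpha> \<beta> = (THE c. \<exists>i e. lev \<alpha> \<beta> i \<and> proj \<alpha> \<beta> i e \<and> c = T i e)" for \<alpha> \<beta>
  have lev_unique: "i = j" if "lev \<alpha> \<beta> i" "lev \<alpha> \<beta> j" for \<alpha> \<beta> i j
  proof -
    have ij: "i \<in> levels" "j \<in> levels" using that unfolding lev_def by auto
    have False if "lev \<alpha> \<beta> i" "lev \<alpha> \<beta> j" "ltw m i j" for i j
      using that ltw_asym[OF wo_L] ltw_imp_le unfolding lev_def by metis
    then have "\<not> ltw m i j" "\<not> ltw m j i" using that by blast+
    then show ?thesis
      using not_ltw[OF wo_m levels_Field[OF ij(1)] levels_Field[OF ij(2)]] unfolding ltw_def by blast
  qed
  have proj_unique: "e = e'" if "proj \<alpha> \<beta> i e" "proj \<alpha> \<beta> i e'" "i \<in> levels" for \<alpha> \<beta> i e e'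
    using that wo_L[OF that(3)] unfolding proj_def order_on_defs by (metis antisymD)
  have col: "col \<alpha> \<beta> = T i e" if "lev \<alpha> \<beta> i" "proj \<alpha> \<beta> i e" for \<alpha> \<beta> i e
    unfolding col_def
  proof (rule the_equality)
    fix c assume "\<exists>i e. lev \<alpha> \<beta> i \<and> proj \<alpha> \<beta> i e \<and> c = T i e"
    then obtain i' e' where *: "lev \<alpha> \<beta> i'" "proj \<alpha> \<beta> i' e'" "c = T i' e'" by blast
    have "i' = i" by (rule lev_unique[OF *(1) that(1)])
    moreover have "i \<in> levels" using that(1) unfolding lev_def by blast
    ultimately show "c = T i e" using proj_unique that(2) * by metis
  qed (use that in blast)
  have "\<exists>a\<in>A. \<exists>b\<in>A. \<forall>\<alpha>\<in>a. \<forall>\<beta>\<in>b. ltw k \<alpha> \<beta> \<and> col \<alpha> \<beta> = \<gamma>"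
    if X: "less_cf X m" and A: "\<forall>a\<in>A. a \<subseteq> Field k \<and> |a| \<le>o |X|"
      and unb: "k_unbounded A" and \<gamma>: "\<gamma> \<in> Field m" for X :: "'b set" and A \<gamma>
  proof -
    have cf: "less_cf a m" if "a \<in> A" for a using less_cf_mono[OF X] A that by blast
    have AK: "\<alpha> \<in> Field k" if "a \<in> A" "\<alpha> \<in> a" for a \<alpha> using A that by blast
    \<comment> \<open>Domination by single ordinals becomes domination by all \<beta> in
      \<open>b\<close> from one threshold on, since \<open>b\<close> has fewer than cf(\<mu>)
      elements.\<close>
    have dom: "\<exists>g\<in>Field k. \<forall>b\<in>A. (\<forall>\<beta>\<in>b. ltw k g \<beta>) \<longrightarrow>
        (\<exists>c\<in>Field m. \<forall>i\<in>levels. ltw m c i \<longrightarrow>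
           (\<forall>\<beta>\<in>b. \<forall>u\<in>Field (L i). ltw (L i) (G i u) (B \<beta> i u)))"
      if G: "\<forall>i\<in>levels. \<forall>u\<in>Field (L i). G i u \<in> Field (L i)" for G
    proof -
      obtain g where g: "g \<in> Field k" "\<And>b. ltw k g b \<Longrightarrow> (\<exists>c\<in>Field m. \<forall>i\<in>levels. ltw m c i \<longrightarrow>
           (\<forall>u\<in>Field (L i). ltw (L i) (G i u) (B b i u)))" using B_dom[OF G] by blast
      have "\<exists>c\<in>Field m. \<forall>i\<in>levels. ltw m c i \<longrightarrow>
           (\<forall>\<beta>\<in>b. \<forall>u\<in>Field (L i). ltw (L i) (G i u) (B \<beta> i u))"
        if b: "b \<in> A" "\<forall>\<beta>\<in>b. ltw k g \<beta>" for b
        by (rule eventually_all[OF cf[OF b(1)]]) (rule g(2), use b(2) in blast)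
      then show ?thesis using g(1) by blast
    qed
    define good where "good i \<longleftrightarrow> (\<forall>u\<in>Field (L i). \<exists>a\<in>A. \<forall>\<alpha>\<in>a. ltw (L i) u (f \<alpha> i))" for i
    have "\<exists>c\<in>Field m. \<forall>i\<in>levels. ltw m c i \<longrightarrow> good i"
    proof (rule ccontr)
      assume contra: "\<not> ?thesis"
      \<comment> \<open>At a bad level \<open>G i\<close> is a constant that no member of
        \<open>A\<close> clears. A member of \<open>A\<close> above the index of \<open>G\<close>
        clears it at all large levels, because \<open>f \<alpha> i\<close> is itself a value of
        \<open>B \<alpha> i\<close>.\<close>
      define G where "G i u = (if good i then u else
        (SOME v. v \<in> Field (L i) \<and> (\<forall>a\<in>A. \<not> (\<forall>\<alpha>\<in>a. ltw (L i) v (f \<alpha> i)))))" for i u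
      have Gbad: "G i u \<in> Field (L i) \<and> (\<forall>a\<in>A. \<not> (\<forall>\<alpha>\<in>a. ltw (L i) (G i u) (f \<alpha> i)))"
        if "\<not> good i" for i u
      proof -
        have "\<exists>v. v \<in> Field (L i) \<and> (\<forall>a\<in>A. \<not> (\<forall>\<alpha>\<in>a. ltw (L i) v (f \<alpha> i)))"
          using that unfolding good_def by blast
        from someI_ex[OF this] show ?thesis unfolding G_def using that by simp
      qed
      have "\<forall>i\<in>levels. \<forall>u\<in>Field (L i). G i u \<in> Field (L i)"
        using Gbad unfolding G_def by simp
      from dom[OF this] obtain g where g: "g \<in> Field k" "\<forall>b\<in>A. (\<forall>\<beta>\<in>b. ltw k g \<beta>) \<longrightarrow>
        (\<exists>c\<in>Field m. \<forall>i\<in>levels. ltw m c i \<longrightarrow>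
           (\<forall>\<beta>\<in>b. \<forall>u\<in>Field (L i). ltw (L i) (G i u) (B \<beta> i u)))" by blast
      obtain a where a: "a \<in> A" "\<forall>\<alpha>\<in>a. ltw k g \<alpha>" using unb g(1) unfolding k_unbounded_def by blast
      from mp[OF bspec[OF g(2) a(1)] a(2)]
      obtain c where c: "c \<in> Field m" "\<And>i \<alpha> u. i \<in> levels \<Longrightarrow> ltw m c i \<Longrightarrow> \<alpha> \<in> a \<Longrightarrow>
          u \<in> Field (L i) \<Longrightarrow> ltw (L i) (G i u) (B \<alpha> i u)" by blast
      obtain i where i: "i \<in> levels" "ltw m c i" "\<not> good i" using contra c(1) by blast
      have "\<forall>\<alpha>\<in>a. ltw (L i) (G i (bot i)) (f \<alpha> i)"
        unfolding f_def using c(2)[OF i(1,2)] bot(1)[OF i(1)] by blast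
      then show False using Gbad[OF i(3)] a(1) by blast
    qed
    then obtain c1 where c1: "c1 \<in> Field m" "\<And>i. i \<in> levels \<Longrightarrow> ltw m c1 i \<Longrightarrow> good i" by blast
    obtain c2 where c2: "c2 \<in> levels" "ltw m c1 c2" "|X| \<le>o |underS m c2|"
      using levels_cofinal[OF less_cf_less[OF X] c1(1)] by blast
    \<comment> \<open>From \<open>c2\<close> on, every level is good and large enough to bound sets
      of the size of a member of \<open>A\<close>.\<close>
    define J where "J = {i \<in> levels. (c2, i) \<in> m}"
    have J_levels: "i \<in> levels" if "i \<in> J" for i using that unfolding J_def by blast
    have J_good: "good i" if "i \<in> J" for i
      using that c1(2) ltw_le_trans[OF wo_m c2(2)] unfolding J_def by blast
    have J_size: "|a| \<le>o |underS m i|" if "a \<in> A" "i \<in> J" for a i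
    proof -
      have "|a| \<le>o |X|" using A that(1) by blast
      also have "|X| \<le>o |underS m c2|" by (rule c2(3))
      also have "|underS m c2| \<le>o |underS m i|" using that(2) unfolding J_def by (intro underS_m_mono) simp
      finally show ?thesis .
    qed
    have "\<exists>a\<in>A. \<forall>\<alpha>\<in>a. ltw (L i) u (f \<alpha> i)" if "i \<in> J" "u \<in> Field (L i)" for i u
      using J_good[OF that(1)] that(2) unfolding good_def by blast
    then obtain aa where aa: "\<And>i u. i \<in> J \<Longrightarrow> u \<in> Field (L i) \<Longrightarrow> aa i u \<in> A"
      "\<And>i u \<alpha>. i \<in> J \<Longrightarrow> u \<in> Field (L i) \<Longrightarrow> \<alpha> \<in> aa i u \<Longrightarrow> ltw (L i) u (f \<alpha> i)" by metis
    have "|SIGMA i:J. Field (L i)| \<le>o |Field m|"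
    proof (rule card_of_Sigma_ordLeq_infinite[OF inf_m])
      show "|J| \<le>o |Field m|" by (rule card_of_mono1) (auto dest: J_levels levels_Field)
      show "\<forall>i\<in>J. |Field (L i)| \<le>o |Field m|"
        using ordLess_imp_ordLeq[OF L_less_m] J_levels levels_Field unfolding ordLeq_Field_m by blast
    qed
    \<comment> \<open>All the chosen sets together have size at most \<mu>, so one \<delta> lies
      above them; taking \<open>b\<close> beyond \<delta> will put every \<alpha> below every
      \<beta>.\<close>
    then have "|\<Union>(i, u)\<in>(SIGMA i:J. Field (L i)). aa i u| \<le>o |Field m|"
    proof (rule card_of_UNION_ordLeq_infinite[OF inf_m], intro ballI)
      fix p assume "p \<in> (SIGMA i:J. Field (L i))"
      then obtain i u where p: "p = (i, u)" "i \<in> J" "u \<in> Field (L i)" by blast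
      have "|aa i u| \<le>o |underS m i|" using J_size aa(1) p(2,3) by blast
      also have "|underS m i| \<le>o |Field m|" by (rule card_of_mono1) (auto simp: underS_def Field_def)
      finally show "|case p of (i, u) \<Rightarrow> aa i u| \<le>o |Field m|" using p(1) by simp
    qed
    moreover have "(\<Union>(i, u)\<in>(SIGMA i:J. Field (L i)). aa i u) \<subseteq> Field k" using AK aa(1) by auto
    ultimately obtain \<delta> where \<delta>: "\<delta> \<in> Field k"
      "\<And>i u \<alpha>. i \<in> J \<Longrightarrow> u \<in> Field (L i) \<Longrightarrow> \<alpha> \<in> aa i u \<Longrightarrow> ltw k \<alpha> \<delta>"
      using succ_k.small_bounded by (metis (no_types, lifting) SigmaI UN_I case_prod_conv)
    define bd where "bd i u y \<longleftrightarrow> y \<in> Field (L i) \<and> (\<forall>\<alpha>\<in>aa i u. ltw (L i) (f \<alpha> i) y) \<and>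
        (\<forall>j\<in>J. \<forall>w\<in>Field (L j). \<forall>\<alpha>\<in>aa j w. ltw m j i \<longrightarrow> ltw (L i) (f \<alpha> i) y)" for i u y
    have "\<exists>y. bd i u y"
      if i: "i \<in> J" and u: "u \<in> Field (L i)" for i u
    proof -
      define Q where "Q = (\<Union>(j, w)\<in>(SIGMA j:{j \<in> J. ltw m j i}. Field (L j)). aa j w)"
      have inf: "infinite (underS m i)" using J_levels[OF i] unfolding levels_def by blast
      have "|SIGMA j:{j \<in> J. ltw m j i}. Field (L j)| \<le>o |underS m i|"
      proof (rule card_of_Sigma_ordLeq_infinite[OF inf])
        show "|{j \<in> J. ltw m j i}| \<le>o |underS m i|" by (rule card_of_mono1) (auto simp: underS_iff_ltw)
        show "\<forall>j\<in>{j \<in> J. ltw m j i}. |Field (L j)| \<le>o |underS m i|"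
          using L_le_level J_levels i by blast
      qed
      then have "|Q| \<le>o |underS m i|"
        unfolding Q_def
      proof (rule card_of_UNION_ordLeq_infinite[OF inf], intro ballI)
        fix p assume "p \<in> (SIGMA j:{j \<in> J. ltw m j i}. Field (L j))"
        then obtain j w where p: "p = (j, w)" "j \<in> J" "w \<in> Field (L j)" by blast
        show "|case p of (j, w) \<Rightarrow> aa j w| \<le>o |underS m i|"
          using J_size[OF aa(1)[OF p(2,3)] i] p(1) by simp
      qed
      then have "|aa i u \<union> Q| \<le>o |underS m i|"
        using J_size[OF aa(1)[OF i u] i] inf
        by (intro card_of_Un_ordLeq_infinite_Field[of "|underS m i|", unfolded Field_card_of])
          (auto simp: card_of_card_order_on)
      moreover have "w \<in> Field k" if "w \<in> aa i u \<union> Q" for w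
        using that aa(1) i u AK unfolding Q_def by blast
      then have "f w i \<in> Field (L i)" if "w \<in> aa i u \<union> Q" for w
        using that f J_levels[OF i] by blast
      ultimately have "\<exists>y\<in>Field (L i). \<forall>\<alpha>\<in>aa i u \<union> Q. ltw (L i) (f \<alpha> i) y"
        by (rule succ_card.image_bounded[OF succ_card_L[OF J_levels[OF i]]])
      then obtain y where y: "y \<in> Field (L i)" "\<forall>\<alpha>\<in>aa i u \<union> Q. ltw (L i) (f \<alpha> i) y"
        by blast
      have "\<alpha> \<in> Q" if "j \<in> J" "w \<in> Field (L j)" "\<alpha> \<in> aa j w" "ltw m j i" for j w \<alpha>
        unfolding Q_def using that by auto
      with y show ?thesis unfolding bd_def by blast
    qed
    then obtain H where bd: "\<And>i u. i \<in> J \<Longrightarrow> u \<in> Field (L i) \<Longrightarrow> bd i u (H i u)" by metis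
    have H: "i \<in> J \<Longrightarrow> u \<in> Field (L i) \<Longrightarrow> H i u \<in> Field (L i)"
      "\<And>\<alpha>. i \<in> J \<Longrightarrow> u \<in> Field (L i) \<Longrightarrow> \<alpha> \<in> aa i u \<Longrightarrow> ltw (L i) (f \<alpha> i) (H i u)"
      "\<And>j w \<alpha>. i \<in> J \<Longrightarrow> u \<in> Field (L i) \<Longrightarrow> j \<in> J \<Longrightarrow> w \<in> Field (L j) \<Longrightarrow> \<alpha> \<in> aa j w \<Longrightarrow>
        ltw m j i \<Longrightarrow> ltw (L i) (f \<alpha> i) (H i u)" for i u
      using bd[of i u] unfolding bd_def by simp_all
    define G where "G i u = (if i \<in> J then H i u else u)" for i u
    have "\<forall>i\<in>levels. \<forall>u\<in>Field (L i). G i u \<in> Field (L i)" using H(1) unfolding G_def by simp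
    from dom[OF this] obtain g where g: "g \<in> Field k" "\<forall>b\<in>A. (\<forall>\<beta>\<in>b. ltw k g \<beta>) \<longrightarrow>
        (\<exists>c\<in>Field m. \<forall>i\<in>levels. ltw m c i \<longrightarrow>
           (\<forall>\<beta>\<in>b. \<forall>u\<in>Field (L i). ltw (L i) (G i u) (B \<beta> i u)))" by blast
    obtain g' where g': "g' \<in> Field k" "(g, g') \<in> k" "(\<delta>, g') \<in> k"
      using not_ltw[OF wo_k g(1) \<delta>(1)] ltw_imp_le[of k g \<delta>] Well_order_refl[OF wo_k] g(1) \<delta>(1) by metis
    obtain b where b: "b \<in> A" "\<And>\<beta>. \<beta> \<in> b \<Longrightarrow> ltw k g' \<beta>" using unb g'(1) unfolding k_unbounded_def by blast
    have "\<forall>\<beta>\<in>b. ltw k g \<beta>" using le_ltw_trans[OF wo_k g'(2)] b(2) by blast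
    from mp[OF bspec[OF g(2) b(1)] this] obtain c where c: "c \<in> Field m" "\<And>i \<beta> u. i \<in> levels \<Longrightarrow> ltw m c i \<Longrightarrow> \<beta> \<in> b \<Longrightarrow>
        u \<in> Field (L i) \<Longrightarrow> ltw (L i) (G i u) (B \<beta> i u)" by blast
    \<comment> \<open>The level \<open>i\<close> must exceed \<open>c\<close>, where
      \<open>b\<close> starts to dominate \<open>G\<close>, \<open>c2\<close>, so that it is in
      \<open>J\<close>, and \<gamma>, so that \<gamma> is a colour taken by
      \<open>T i\<close>.\<close>
    obtain d1 where d1: "d1 \<in> Field m" "(c, d1) \<in> m" "(c2, d1) \<in> m"
      using upper_bound2[OF c(1) levels_Field[OF c2(1)]] by blast
    obtain d where d: "d \<in> Field m" "(d1, d) \<in> m" "(\<gamma>, d) \<in> m" using upper_bound2[OF d1(1) \<gamma>] by blast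
    obtain i where i: "i \<in> levels" "ltw m d i" using levels_cofinal[OF less_cf_less[OF X] d(1)] by blast
    have d1i: "ltw m d1 i" using le_ltw_trans[OF wo_m d(2) i(2)] .
    have ci: "ltw m c i" using le_ltw_trans[OF wo_m d1(2) d1i] .
    have iJ: "i \<in> J" unfolding J_def using i(1) ltw_imp_le[OF le_ltw_trans[OF wo_m d1(3) d1i]] by blast
    have \<gamma>i: "\<gamma> \<in> underS m i" using le_ltw_trans[OF wo_m d(3) i(2)] by (simp add: underS_iff_ltw)
    obtain F where F: "\<And>u. u \<in> Field (L i) \<Longrightarrow> F u \<in> Field (L i)"
      "\<And>u \<beta>. u \<in> Field (L i) \<Longrightarrow> \<beta> \<in> b \<Longrightarrow> ltw (L i) (B \<beta> i u) (F u)"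
      using succ_card.family_dominated[OF succ_card_L[OF i(1)] J_size[OF b(1) iJ], of "\<lambda>\<beta>. B \<beta> i"]
        B[OF AK[OF b(1)] i(1)] by blast
    obtain e where e: "e \<in> closure_points (L i) F" "T i e = \<gamma>" using T[OF i(1) _ \<gamma>i, of F] F(1) by blast
    have eB: "e \<in> closure_points (L i) (B \<beta> i)" if "\<beta> \<in> b" for \<beta>
      using succ_card.closure_points_antimono[OF succ_card_L[OF i(1)], of "B \<beta> i" F] F(2) that e(1) by blast
    have eL: "e \<in> Field (L i)" using e(1) unfolding closure_points_def by blast
    have "ltw k \<alpha> \<beta> \<and> col \<alpha> \<beta> = \<gamma>" if \<alpha>: "\<alpha> \<in> aa i e" and \<beta>: "\<beta> \<in> b" for \<alpha> \<beta>
    proof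
      show "ltw k \<alpha> \<beta>"
        using ltw_le_trans[OF wo_k \<delta>(2)[OF iJ eL \<alpha>] g'(3)] ltw_trans[OF wo_k] b(2)[OF \<beta>] by blast
      have e\<alpha>: "ltw (L i) e (f \<alpha> i)" by (rule aa(2)[OF iJ eL \<alpha>])
      have "lev \<alpha> \<beta> i"
        unfolding lev_def
      proof (intro conjI ballI impI)
        obtain u where u: "ltw (L i) u e" using eB[OF \<beta>] unfolding closure_points_def by blast
        \<comment> \<open>As \<open>f \<beta> i\<close> is the value of \<open>B \<beta> i\<close>
          at \<open>bot i\<close>, any closure point exceeds it. Above level \<open>i\<close> the
          order is reversed: there \<open>f \<beta> j\<close> exceeds the bound \<open>H\<close> of
          all earlier choices.\<close>
        have "ltw (L i) (bot i) e"
          using le_ltw_trans[OF wo_L[OF i(1)] bot(2)[OF i(1) ltw_Field(1)[OF u]] u] .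
        then have "ltw (L i) (f \<beta> i) e" using eB[OF \<beta>] unfolding closure_points_def f_def by blast
        then show "ltw (L i) (f \<beta> i) (f \<alpha> i)" using e\<alpha> by (rule ltw_trans[OF wo_L[OF i(1)]])
        fix j assume j: "j \<in> levels" "ltw m i j"
        have "(c2, j) \<in> m"
          using iJ ltw_imp_le[OF le_ltw_trans[OF wo_m _ j(2)]] unfolding J_def by blast
        then have jJ: "j \<in> J" unfolding J_def using j(1) by blast
        have "ltw (L j) (f \<alpha> j) (G j (bot j))"
          using H(3)[OF jJ bot(1)[OF j(1)] iJ eL \<alpha> j(2)] jJ unfolding G_def by simp
        moreover have "ltw (L j) (G j (bot j)) (f \<beta> j)"
          unfolding f_def by (rule c(2)[OF j(1) ltw_trans[OF wo_m ci j(2)] \<beta> bot(1)[OF j(1)]])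
        ultimately show "ltw (L j) (f \<alpha> j) (f \<beta> j)" by (rule ltw_trans[OF wo_L[OF j(1)]])
      qed (rule i(1))
      moreover have "proj \<alpha> \<beta> i e"
        unfolding proj_def
      proof (intro conjI ballI impI)
        fix z assume z: "z \<in> closure_points (L i) (B \<beta> i)" "(z, f \<alpha> i) \<in> L i"
        show "(z, e) \<in> L i"
        proof (rule ccontr)
          assume "(z, e) \<notin> L i"
          moreover have "z \<in> Field (L i)" using z(1) unfolding closure_points_def by blast
          \<comment> \<open>A closure point beyond \<open>e\<close> would exceed
            \<open>B \<beta> i e\<close>, which is already above \<open>H i e\<close> and hence
            above \<open>f \<alpha> i\<close>.\<close>
          ultimately have "ltw (L i) e z" using not_ltw[OF wo_L[OF i(1)] eL] by blast
          then have "ltw (L i) (B \<beta> i e) z" using z(1) unfolding closure_points_def by blast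
          then have 1: "ltw (L i) (B \<beta> i e) (f \<alpha> i)" using z(2) by (rule ltw_le_trans[OF wo_L[OF i(1)]])
          have "ltw (L i) (f \<alpha> i) (G i e)" using H(2)[OF iJ eL \<alpha>] iJ unfolding G_def by simp
          from ltw_trans[OF wo_L[OF i(1)] this c(2)[OF i(1) ci \<beta> eL]]
          have "(f \<alpha> i, B \<beta> i e) \<in> L i" by (rule ltw_imp_le)
          then show False using ltw_asym[OF wo_L[OF i(1)] 1] by contradiction
        qed
      qed (rule eB[OF \<beta>], rule ltw_imp_le[OF e\<alpha>])
      ultimately show "col \<alpha> \<beta> = \<gamma>" using col e(2) by simp
    qed
    then show ?thesis using aa(1)[OF iJ eL] b(1) by blast
  qed
  then show ?thesis by (intro exI[of _ col] allI impI)
qed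

section \<open>Matrices of colours\<close>

lemma inf_k: "infinite (Field k)"
  using card_of_ordLeq_infinite[OF ordLess_imp_ordLeq inf_m] succ_k.X_less
    ordLess_ordIso_trans[OF _ ordIso_symmetric[OF Field_k]] by blast

lemma Field_k_inj_Pow: "\<exists>tag :: 'a \<Rightarrow> 'a set. inj_on tag (Field k) \<and> tag ` Field k \<subseteq> Pow (Field m)"
proof -
  have "k \<le>o |Pow (Field m)|"
    using ordIso_ordLeq_trans[OF succ_k.r_succ cardSuc_least[OF card_of_Card_order card_of_Card_order card_of_Pow]] .
  then have "|Field k| \<le>o |Pow (Field m)|" by (rule ordIso_ordLeq_trans[OF Field_k])
  then show ?thesis by (rule iffD2[OF card_of_ordLeq])
qed

text \<open>If every member of \<open>A\<close> met the elements up to \<open>g\<close>,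
  disjointness would make the choice of such points an injection of \<open>A\<close> into a proper
  initial segment of \<open>k\<close>.\<close>

lemma k_unbounded_if_disjoint:
  assumes "|A| =o k" and disj: "\<forall>a\<in>A. \<forall>b\<in>A. a \<noteq> b \<longrightarrow> a \<inter> b = {}"
    and sub: "\<forall>a\<in>A. a \<subseteq> Field k"
  shows "k_unbounded A"
  unfolding k_unbounded_def
proof (rule ballI, rule ccontr)
  fix g assume g: "g \<in> Field k" and "\<not> (\<exists>a\<in>A. \<forall>\<alpha>\<in>a. ltw k g \<alpha>)"
  then obtain w where w: "\<And>a. a \<in> A \<Longrightarrow> w a \<in> a" "\<And>a. a \<in> A \<Longrightarrow> \<not> ltw k g (w a)" by metis
  obtain h where h: "ltw k g h" "h \<in> Field k"
    using infinite_Card_order_limit[OF Card_k inf_k g] unfolding ltw_def by blast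
  have "inj_on w A"
  proof (rule inj_onI)
    fix a b assume "a \<in> A" "b \<in> A" "w a = w b"
    then have "w a \<in> a \<inter> b" using w(1)[of a] w(1)[of b] by simp
    then show "a = b" using disj \<open>a \<in> A\<close> \<open>b \<in> A\<close> by blast
  qed
  moreover have "w ` A \<subseteq> underS k h"
  proof
    fix x assume "x \<in> w ` A"
    then obtain a where a: "a \<in> A" "x = w a" by blast
    then have "x \<in> Field k" using w(1)[OF a(1)] sub by blast
    then have "(x, g) \<in> k" using not_ltw[OF wo_k g] w(2)[OF a(1)] a(2) by simp
    then show "x \<in> underS k h" using le_ltw_trans[OF wo_k _ h(1)] by (simp add: underS_iff_ltw)
  qed
  ultimately have "|A| \<le>o |underS k h|" using card_of_ordLeq by metis
  then have "|A| <o k" using card_of_underS[OF Card_k h(2)] by (rule ordLeq_ordLess_trans)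
  then have "\<not> |A| =o k" by (rule not_ordLess_ordIso)
  then show False using assms(1) by contradiction
qed

text \<open>If each of the at most \<mu> fibres failed at some \<open>g x\<close>, a member of
  \<open>A\<close> above a common bound of these would belong to no fibre.\<close>

lemma k_unbounded_fibre:
  assumes "k_unbounded A" "d ` A \<subseteq> D" "|D| \<le>o m"
  shows "\<exists>x\<in>D. k_unbounded {a \<in> A. d a = x}"
proof (rule ccontr)
  assume contra: "\<not> ?thesis"
  have "\<exists>g. g \<in> Field k \<and> (\<forall>a. a \<in> A \<longrightarrow> d a = x \<longrightarrow> \<not> (\<forall>\<alpha>\<in>a. ltw k g \<alpha>))" if "x \<in> D" for x
  proof -
    have "\<not> k_unbounded {a \<in> A. d a = x}" using contra that by blast
    then obtain g where g: "g \<in> Field k" "\<not> (\<exists>a\<in>{a \<in> A. d a = x}. \<forall>\<alpha>\<in>a. ltw k g \<alpha>)"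
      unfolding k_unbounded_def by blast
    show ?thesis by (rule exI[of _ g]) (use g in simp)
  qed
  then obtain g where g: "\<And>x. x \<in> D \<Longrightarrow> g x \<in> Field k"
    "\<And>x a. x \<in> D \<Longrightarrow> a \<in> A \<Longrightarrow> d a = x \<Longrightarrow> \<not> (\<forall>\<alpha>\<in>a. ltw k (g x) \<alpha>)" by metis
  obtain h where h: "h \<in> Field k" "\<And>x. x \<in> D \<Longrightarrow> ltw k (g x) h"
    using succ_k.image_bounded[of D g] assms(3) g(1) unfolding ordLeq_Field_m by blast
  obtain a where a: "a \<in> A" "\<And>\<alpha>. \<alpha> \<in> a \<Longrightarrow> ltw k h \<alpha>"
    using assms(1) h(1) unfolding k_unbounded_def by blast
  have "d a \<in> D" using a(1) assms(2) by blast
  have "\<forall>\<alpha>\<in>a. ltw k (g (d a)) \<alpha>" using ltw_trans[OF wo_k h(2)[OF \<open>d a \<in> D\<close>]] a(2) by blast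
  then show False using g(2)[OF \<open>d a \<in> D\<close> a(1) refl] by contradiction
qed

lemma k_unbounded_above:
  assumes "k_unbounded A" "g \<in> Field k"
  shows "k_unbounded {a \<in> A. \<forall>\<alpha>\<in>a. ltw k g \<alpha>}"
  unfolding k_unbounded_def
proof
  fix h assume h: "h \<in> Field k"
  obtain e where e: "e \<in> Field k" "(g, e) \<in> k" "(h, e) \<in> k"
    using not_ltw[OF wo_k assms(2) h] ltw_imp_le[of k g h] Well_order_refl[OF wo_k] assms(2) h by metis
  obtain a where "a \<in> A" "\<forall>\<alpha>\<in>a. ltw k e \<alpha>" using assms(1) e(1) unfolding k_unbounded_def by blast
  then show "\<exists>a\<in>{a \<in> A. \<forall>\<alpha>\<in>a. ltw k g \<alpha>}. \<forall>\<alpha>\<in>a. ltw k h \<alpha>"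
    using le_ltw_trans[OF wo_k e(2)] le_ltw_trans[OF wo_k e(3)] by blast
qed

lemma levels_Sigma_le:
  assumes "\<And>i. i \<in> levels \<Longrightarrow> |Y i| <o m"
  shows "|SIGMA i:levels. Y i| \<le>o m"
proof (rule card_of_Sigma_ordLeq_infinite_Field[OF inf_m Card_m])
  show "|levels| \<le>o m"
    unfolding ordLeq_Field_m by (rule card_of_mono1) (auto simp: levels_def)
  show "\<forall>i\<in>levels. |Y i| \<le>o m" using assms ordLess_imp_ordLeq by blast
qed

text \<open>A colour codes a level \<open>i\<close> and a table \<open>W\<close>. Ordinals are recognised by the trace of \<open>tag \<alpha>\<close>
  below \<open>i\<close>, and the table entry names, for each \<open>\<beta>\<close>, the preimage under \<open>code \<beta>\<close>. Fewer than
  cf(m) ordinals have distinct traces at some level, and the traces are made independent of \<open>a \<in> A\<close>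
  by the pigeonhole principle.\<close>

lemma matrix_colours:
  "\<exists>g :: 'a \<Rightarrow> 'a \<Rightarrow> 'a. \<forall>(x :: 'a rel) A E z.
     less_cf (Field x) m \<longrightarrow> (\<forall>a\<in>A. a \<subseteq> Field k \<and> bij_betw (E a) (Field x) a) \<longrightarrow>
     k_unbounded A \<longrightarrow> (\<forall>i\<in>Field x. \<forall>j\<in>Field x. z i j \<in> Field k) \<longrightarrow>
     (\<exists>a\<in>A. \<exists>b\<in>A. (\<forall>\<alpha>\<in>a. \<forall>\<beta>\<in>b. ltw k \<alpha> \<beta>) \<and>
        (\<forall>i\<in>Field x. \<forall>j\<in>Field x. g (E a i) (E b j) = z i j))"
proof -
  obtain col :: "'a \<Rightarrow> 'a \<Rightarrow> 'a" where col0: "\<forall>(X :: 'a set) A \<gamma>. less_cf X m \<longrightarrow>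
      (\<forall>a\<in>A. a \<subseteq> Field k \<and> |a| \<le>o |X| ) \<longrightarrow> k_unbounded A \<longrightarrow> \<gamma> \<in> Field m \<longrightarrow>
     (\<exists>a\<in>A. \<exists>b\<in>A. \<forall>\<alpha>\<in>a. \<forall>\<beta>\<in>b. ltw k \<alpha> \<beta> \<and> col \<alpha> \<beta> = \<gamma>)"
    using constant_colours[where 'b = 'a] by (rule exE)
  note col = col0[THEN spec, THEN spec, THEN spec, THEN mp, THEN mp, THEN mp, THEN mp]
  obtain code where code: "\<And>b. b \<in> Field k \<Longrightarrow> inj_on (code b) (underS k b)"
    "\<And>b. b \<in> Field k \<Longrightarrow> code b ` underS k b \<subseteq> Field m"
    using underS_k_inj by metis
  obtain tag :: "'a \<Rightarrow> 'a set" where tag: "inj_on tag (Field k)" "tag ` Field k \<subseteq> Pow (Field m)"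
    using Field_k_inj_Pow by blast
  let ?U = "\<lambda>i. underS m i"
  let ?C = "SIGMA i:levels. Pow (Pow (?U i) \<times> Pow (?U i) \<times> ?U i)"
  have U: "|?U i| <o m" if "i \<in> levels" for i using card_of_underS[OF Card_m levels_Field[OF that]] .
  have "|?C| \<le>o |Field m|"
    unfolding ordLeq_Field_m[symmetric] by (intro levels_Sigma_le strong_limit Times_less_m U)
  moreover have "?C \<noteq> {}"
  proof -
    obtain c where "c \<in> Field m" using inf_m by (metis ex_in_conv finite.emptyI)
    then obtain i where "i \<in> levels" using levels_cofinal[OF uncountable_m] by blast
    then show ?thesis by blast
  qed
  ultimately have "\<exists>dec. dec ` Field m = ?C" by (rule iffD2[OF card_of_ordLeq2, rotated])
  then obtain dec where dec: "dec ` Field m = ?C" ..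
  \<comment> \<open>The constant colour supplies a level and a table; the traces of the two tags
    locate the matrix entry in the table, which is stored as a code relative to \<beta>.\<close>
  define g where "g \<alpha> \<beta> = (case dec (col \<alpha> \<beta>) of (i, W) \<Rightarrow>
      inv_into (underS k \<beta>) (code \<beta>) (THE e. (tag \<alpha> \<inter> ?U i, tag \<beta> \<inter> ?U i, e) \<in> W))" for \<alpha> \<beta>
  have "\<exists>a\<in>A. \<exists>b\<in>A. (\<forall>\<alpha>\<in>a. \<forall>\<beta>\<in>b. ltw k \<alpha> \<beta>) \<and>
        (\<forall>i\<in>Field x. \<forall>j\<in>Field x. g (E a i) (E b j) = z i j)"
    if x: "less_cf (Field x) m" and A: "\<forall>a\<in>A. a \<subseteq> Field k \<and> bij_betw (E a) (Field x) a"
      and unb: "k_unbounded A" and z: "\<forall>i\<in>Field x. \<forall>j\<in>Field x. z i j \<in> Field k"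
    for x :: "'a rel" and A E z
  proof -
    let ?x = "Field x"
    have xm: "|?x| <o m" using less_cf_less[OF x] .
    have "|?x \<times> ?x| \<le>o |Field m|"
      unfolding ordLeq_Field_m[symmetric] by (intro ordLess_imp_ordLeq Times_less_m xm)
    then have "\<exists>\<delta>\<in>Field k. \<forall>p\<in>?x \<times> ?x. ltw k ((\<lambda>(i, j). z i j) p) \<delta>"
      by (rule succ_k.image_bounded) (use z in auto)
    then obtain \<delta> where \<delta>: "\<delta> \<in> Field k" "\<And>i j. i \<in> ?x \<Longrightarrow> j \<in> ?x \<Longrightarrow> ltw k (z i j) \<delta>" by auto
    \<comment> \<open>Above the bound \<delta> of the matrix, each entry precedes every element of
      every \<open>a\<close>, so \<open>code\<close> applies to it.\<close>
    define A1 where "A1 = {a \<in> A. \<forall>\<alpha>\<in>a. ltw k \<delta> \<alpha>}"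
    have A1: "k_unbounded A1" unfolding A1_def by (rule k_unbounded_above[OF unb \<delta>(1)])
    have E: "E a i \<in> a" "E a i \<in> Field k" if "a \<in> A" "i \<in> ?x" for a i
      using A that unfolding bij_betw_def by blast+
    have zE: "z i j \<in> underS k (E a j)" if "a \<in> A1" "i \<in> ?x" "j \<in> ?x" for a i j
    proof -
      have "ltw k \<delta> (E a j)" using that E(1) unfolding A1_def by blast
      then show ?thesis using ltw_trans[OF wo_k \<delta>(2)] that(2,3) unfolding underS_iff_ltw by blast
    qed
    have cz: "code (E a j) (z i j) \<in> Field m" if "a \<in> A1" "i \<in> ?x" "j \<in> ?x" for a i j
      using code(2)[OF E(2)] zE that unfolding A1_def by blast
    define sep where "sep a l \<longleftrightarrow> (\<forall>i\<in>?x. \<forall>j\<in>?x. ltw m (code (E a j) (z i j)) l \<and>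
        (i \<noteq> j \<longrightarrow> tag (E a i) \<inter> ?U l \<noteq> tag (E a j) \<inter> ?U l))" for a l
    have "\<exists>l\<in>levels. sep a l" if a: "a \<in> A1" for a
    proof -
      have aA: "a \<in> A" using a unfolding A1_def by blast
      have "\<exists>c\<in>Field m. \<forall>l\<in>levels. ltw m c l \<longrightarrow> ltw m (code (E a j) (z i j)) l \<and>
          (i \<noteq> j \<longrightarrow> tag (E a i) \<inter> ?U l \<noteq> tag (E a j) \<inter> ?U l)" if ij: "i \<in> ?x" "j \<in> ?x" for i j
      proof (cases "i = j")
        case True
        then show ?thesis using cz[OF a ij] by blast
      next
        case False
        have "E a i \<noteq> E a j" using A aA ij False unfolding bij_betw_def inj_on_def by blast
        then have "tag (E a i) \<noteq> tag (E a j)" using tag(1) E(2)[OF aA] ij unfolding inj_on_def by blast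
        then obtain y where y: "y \<in> tag (E a i) \<longleftrightarrow> y \<notin> tag (E a j)" by blast
        have "y \<in> Field m" using y tag(2) E(2)[OF aA] ij by blast
        then obtain c where c: "c \<in> Field m" "(y, c) \<in> m" "(code (E a j) (z i j), c) \<in> m"
          using upper_bound2 cz[OF a ij] by metis
        have "tag (E a i) \<inter> ?U l \<noteq> tag (E a j) \<inter> ?U l" if "ltw m c l" for l
        proof -
          have "y \<in> ?U l" using le_ltw_trans[OF wo_m c(2) that] by (simp add: underS_iff_ltw)
          then show ?thesis using y by blast
        qed
        then show ?thesis using c(1) le_ltw_trans[OF wo_m c(3)] by blast
      qed
      then have "\<exists>c\<in>Field m. \<forall>l\<in>levels. ltw m c l \<longrightarrow> (\<forall>j\<in>?x. ltw m (code (E a j) (z i j)) l \<and>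
          (i \<noteq> j \<longrightarrow> tag (E a i) \<inter> ?U l \<noteq> tag (E a j) \<inter> ?U l))" if "i \<in> ?x" for i
        by (rule eventually_all[OF x]) (use that in blast)
      then have "\<exists>c\<in>Field m. \<forall>l\<in>levels. ltw m c l \<longrightarrow> sep a l"
        unfolding sep_def by (rule eventually_all[OF x])
      then show ?thesis using levels_cofinal[OF xm] by blast
    qed
    then obtain l where l: "\<And>a. a \<in> A1 \<Longrightarrow> l a \<in> levels" "\<And>a. a \<in> A1 \<Longrightarrow> sep a (l a)" by metis
    \<comment> \<open>Traces and codes are indexed by position, not by ordinal. Fixing both by
      pigeonhole yields one table \<open>W\<close> that serves all pairs from the fibre
      \<open>A2\<close>.\<close>
    define ids where "ids a = {(i, y). i \<in> ?x \<and> y \<in> tag (E a i) \<inter> ?U (l a)}" for a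
    define cds where "cds a = {(i, j, e). i \<in> ?x \<and> j \<in> ?x \<and> e = code (E a j) (z i j)}" for a
    let ?D = "SIGMA i:levels. Pow (?x \<times> ?U i) \<times> Pow (?x \<times> ?x \<times> ?U i)"
    have "|?D| \<le>o m" by (intro levels_Sigma_le strong_limit Times_less_m U xm)
    moreover have "(\<lambda>a. (l a, ids a, cds a)) ` A1 \<subseteq> ?D"
      using l unfolding ids_def cds_def sep_def by (auto simp: underS_iff_ltw)
    ultimately have "\<exists>q\<in>?D. k_unbounded {a \<in> A1. (l a, ids a, cds a) = q}"
      by (rule k_unbounded_fibre[OF A1, rotated])
    then obtain q where q: "q \<in> ?D" "k_unbounded {a \<in> A1. (l a, ids a, cds a) = q}" by (rule bexE)
    obtain i0 d1 d2 where qeq: "q = (i0, d1, d2)" by (rule prod_cases3)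
    have i0: "(i0, d1, d2) \<in> ?D" and fib: "k_unbounded {a \<in> A1. (l a, ids a, cds a) = (i0, d1, d2)}"
      using q unfolding qeq .
    define A2 where "A2 = {a \<in> A1. (l a, ids a, cds a) = (i0, d1, d2)}"
    have A2: "a \<in> A1" "a \<in> A" "l a = i0" "ids a = d1" "cds a = d2" if "a \<in> A2" for a
      using that unfolding A2_def A1_def by auto
    define s where "s i = {y. (i, y) \<in> d1}" for i
    define W where "W = {(s i, s j, e) | i j e. i \<in> ?x \<and> j \<in> ?x \<and> (i, j, e) \<in> d2}"
    have "(i0, W) \<in> ?C" using i0 unfolding W_def s_def by auto
    then obtain \<gamma> where \<gamma>: "\<gamma> \<in> Field m" "dec \<gamma> = (i0, W)" using dec by (metis imageE)
    have "\<forall>a\<in>A2. a \<subseteq> Field k \<and> |a| \<le>o |?x|"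
    proof
      fix a assume "a \<in> A2"
      then have "a \<subseteq> Field k" "E a ` ?x = a" using A A2(2) unfolding bij_betw_def by blast+
      then show "a \<subseteq> Field k \<and> |a| \<le>o |?x|" using card_of_image[of "E a" ?x] by simp
    qed
    from col[OF x this fib[folded A2_def] \<gamma>(1)] obtain a b where ab: "a \<in> A2" "b \<in> A2"
      "\<forall>\<alpha>\<in>a. \<forall>\<beta>\<in>b. ltw k \<alpha> \<beta> \<and> col \<alpha> \<beta> = \<gamma>" by blast
    have s: "tag (E a i) \<inter> ?U i0 = s i" if "a \<in> A2" "i \<in> ?x" for a i
      using A2(3,4)[OF that(1)] that(2) unfolding s_def ids_def by auto
    have s_inj: "i = j" if "s i = s j" "i \<in> ?x" "j \<in> ?x" for i j
      using l(2)[OF A2(1)[OF ab(1)]] A2(3)[OF ab(1)] s[OF ab(1)] that unfolding sep_def by metis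
    have "g (E a i) (E b j) = z i j" if ij: "i \<in> ?x" "j \<in> ?x" for i j
    proof -
      have "col (E a i) (E b j) = \<gamma>" using ab(3) E(1)[OF A2(2)] ab(1,2) ij by blast
      then have "g (E a i) (E b j) =
          inv_into (underS k (E b j)) (code (E b j)) (THE e. (s i, s j, e) \<in> W)"
        unfolding g_def using \<gamma>(2) s ab(1,2) ij by simp
      also have "(THE e. (s i, s j, e) \<in> W) = code (E b j) (z i j)"
      proof (rule the_equality)
        have d2: "(i, j, e) \<in> d2 \<longleftrightarrow> e = code (E b j) (z i j)" for e
          using A2(5)[OF ab(2)] ij unfolding cds_def by auto
        then show "(s i, s j, code (E b j) (z i j)) \<in> W" unfolding W_def using ij by blast
        fix e assume "(s i, s j, e) \<in> W"
        then obtain i' j' where "s i = s i'" "s j = s j'" "i' \<in> ?x" "j' \<in> ?x" "(i', j', e) \<in> d2"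
          unfolding W_def by blast
        then show "e = code (E b j) (z i j)" using s_inj ij d2 by metis
      qed
      also have "inv_into (underS k (E b j)) (code (E b j)) (code (E b j) (z i j)) = z i j"
        using inv_into_f_f[OF code(1)[OF E(2)[OF A2(2)[OF ab(2)] ij(2)]] zE[OF A2(1)[OF ab(2)] ij]] .
      finally show ?thesis .
    qed
    moreover have "\<forall>\<alpha>\<in>a. \<forall>\<beta>\<in>b. ltw k \<alpha> \<beta>" using ab(3) by blast
    ultimately show ?thesis
      by (intro bexI[of _ a] bexI[of _ b] conjI ballI) (auto intro: A2(2) ab(1,2))
  qed
  then show ?thesis by (intro exI[of _ g] allI impI)
qed

section \<open>Elimination of the partitions\<close>

lemma Pr0_seq_if_strong_limit:
  assumes th: "\<forall>\<delta>\<in>Field k. |th \<delta>| \<le>o m"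
    and p: "\<forall>\<delta>\<in>Field k. \<forall>\<alpha>\<in>Field k. \<forall>\<beta>\<in>Field k. ltw k \<alpha> \<beta> \<longrightarrow> p \<delta> \<alpha> \<beta> \<in> th \<delta>"
  shows "Pr0_seq k m th p"
proof -
  obtain g :: "'a \<Rightarrow> 'a \<Rightarrow> 'a" where g0: "\<forall>(x :: 'a rel) A E z.
     less_cf (Field x) m \<longrightarrow> (\<forall>a\<in>A. a \<subseteq> Field k \<and> bij_betw (E a) (Field x) a) \<longrightarrow>
     k_unbounded A \<longrightarrow> (\<forall>i\<in>Field x. \<forall>j\<in>Field x. z i j \<in> Field k) \<longrightarrow>
     (\<exists>a\<in>A. \<exists>b\<in>A. (\<forall>\<alpha>\<in>a. \<forall>\<beta>\<in>b. ltw k \<alpha> \<beta>) \<and>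
        (\<forall>i\<in>Field x. \<forall>j\<in>Field x. g (E a i) (E b j) = z i j))"
    using matrix_colours by (rule exE)
  note g = g0[THEN spec, THEN spec, THEN spec, THEN spec, THEN mp, THEN mp, THEN mp, THEN mp]
  obtain tag :: "'a \<Rightarrow> 'a set" where tag: "inj_on tag (Field k)" "tag ` Field k \<subseteq> Pow (Field m)"
    using Field_k_inj_Pow by blast
  \<comment> \<open>With ordinals represented by subsets of \<open>Field m\<close>, a map from
    \<open>th \<delta>\<close> to \<open>Field k\<close> becomes a subset of a product of size at
    most \<mu>, and there are at most \<open>k\<close> of these.\<close>
  let ?C = "SIGMA \<delta>:Field k. Pow (th \<delta> \<times> Field m)"
  have "|?C| \<le>o |Field k|"
  proof (rule card_of_Sigma_ordLeq_infinite[OF inf_k card_of_ordLeq_refl], intro ballI)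
    fix \<delta> assume "\<delta> \<in> Field k"
    then have "|th \<delta> \<times> Field m| \<le>o m"
      using th by (intro card_of_Times_ordLeq_infinite_Field[OF inf_m _ ordIso_imp_ordLeq[OF Field_m] Card_m]) blast
    then show "|Pow (th \<delta> \<times> Field m)| \<le>o |Field k|"
      by (rule ordLeq_ordIso_trans[OF Pow_le_k ordIso_symmetric[OF Field_k]])
  qed
  moreover have "?C \<noteq> {}"
  proof -
    obtain \<delta> where "\<delta> \<in> Field k" using inf_k by (metis ex_in_conv finite.emptyI)
    then show ?thesis by blast
  qed
  ultimately have "\<exists>dec. dec ` Field k = ?C" by (rule iffD2[OF card_of_ordLeq2, rotated])
  then obtain dec where dec: "dec ` Field k = ?C" ..
  define val where "val \<alpha> \<beta> = (case dec (g \<alpha> \<beta>) of (\<delta>, h) \<Rightarrow>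
      inv_into (Field k) tag {y. (p \<delta> \<alpha> \<beta>, y) \<in> h})" for \<alpha> \<beta>
  \<comment> \<open>The default \<alpha> keeps \<open>f\<close> inside \<open>Field k\<close> where
    decoding gives no element of it.\<close>
  define f where "f \<alpha> \<beta> = (if val \<alpha> \<beta> \<in> Field k then val \<alpha> \<beta> else \<alpha>)" for \<alpha> \<beta>
  have main: "\<exists>a\<in>\<A>. \<exists>b\<in>\<A>. (\<forall>\<alpha>\<in>a. \<forall>\<beta>\<in>b. ltw k \<alpha> \<beta>) \<and>
      (\<forall>i\<in>Field x. \<forall>j\<in>Field x. f (E a i) (E b j) = \<zeta> i j (p \<delta> (E a i) (E b j)))"
    if \<delta>: "\<delta> \<in> Field k" and x: "less_cf (Field x) m"
      and A: "\<forall>a\<in>\<A>. a \<subseteq> Field k \<and> enumerates x k a (E a)"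
      and disj: "\<forall>a\<in>\<A>. \<forall>b\<in>\<A>. a \<noteq> b \<longrightarrow> a \<inter> b = {}" and card: "|\<A>| =o k"
      and \<zeta>: "\<forall>i\<in>Field x. \<forall>j\<in>Field x. \<forall>c\<in>th \<delta>. \<zeta> i j c \<in> Field k"
    for \<delta> and x :: "'a rel" and \<A> E \<zeta>
  proof -
    have A': "\<forall>a\<in>\<A>. a \<subseteq> Field k \<and> bij_betw (E a) (Field x) a" using A unfolding enumerates_def by blast
    have unb: "k_unbounded \<A>" using A by (intro k_unbounded_if_disjoint[OF card disj]) blast
    define h where "h i j = {(c, y). c \<in> th \<delta> \<and> y \<in> tag (\<zeta> i j c)}" for i j
    have "(\<delta>, h i j) \<in> ?C" if "i \<in> Field x" "j \<in> Field x" for i j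
    proof -
      have "tag (\<zeta> i j c) \<subseteq> Field m" if "c \<in> th \<delta>" for c
        using tag(2) \<zeta> \<open>i \<in> Field x\<close> \<open>j \<in> Field x\<close> that by blast
      then show ?thesis using \<delta> unfolding h_def by blast
    qed
    then have "(\<delta>, h i j) \<in> dec ` Field k" if "i \<in> Field x" "j \<in> Field x" for i j
      unfolding dec using that .
    then have "\<exists>z. z \<in> Field k \<and> dec z = (\<delta>, h i j)" if "i \<in> Field x" "j \<in> Field x" for i j
      using that by (metis imageE)
    then obtain z where z: "\<forall>i\<in>Field x. \<forall>j\<in>Field x. z i j \<in> Field k"
      "\<And>i j. i \<in> Field x \<Longrightarrow> j \<in> Field x \<Longrightarrow> dec (z i j) = (\<delta>, h i j)" by metis
    obtain a b where ab: "a \<in> \<A>" "b \<in> \<A>" "\<forall>\<alpha>\<in>a. \<forall>\<beta>\<in>b. ltw k \<alpha> \<beta>"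
      "\<And>i j. i \<in> Field x \<Longrightarrow> j \<in> Field x \<Longrightarrow> g (E a i) (E b j) = z i j"
      using g[OF x A' unb z(1)] by blast
    have "f (E a i) (E b j) = \<zeta> i j (p \<delta> (E a i) (E b j))" if ij: "i \<in> Field x" "j \<in> Field x" for i j
    proof -
      let ?c = "p \<delta> (E a i) (E b j)"
      have Ea: "E a i \<in> a" and Eb: "E b j \<in> b" using A' ab(1,2) ij unfolding bij_betw_def by blast+
      then have "E a i \<in> Field k" "E b j \<in> Field k" "ltw k (E a i) (E b j)" using A' ab(1-3) by blast+
      then have c: "?c \<in> th \<delta>" using p \<delta> by blast
      then have \<zeta>k: "\<zeta> i j ?c \<in> Field k" using \<zeta> ij by blast
      have "val (E a i) (E b j) = inv_into (Field k) tag {y. (?c, y) \<in> h i j}"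
        unfolding val_def using ab(4)[OF ij] z(2)[OF ij] by simp
      also have "{y. (?c, y) \<in> h i j} = tag (\<zeta> i j ?c)" unfolding h_def using c by simp
      also have "inv_into (Field k) tag (tag (\<zeta> i j ?c)) = \<zeta> i j ?c" by (rule inv_into_f_f[OF tag(1) \<zeta>k])
      finally show ?thesis unfolding f_def using \<zeta>k by simp
    qed
    with ab(3) show ?thesis
      by (intro bexI[OF _ ab(1)] bexI[OF _ ab(2)] conjI ballI) auto
  qed
  show ?thesis
    unfolding Pr0_seq_def
  proof (rule exI[of _ f], rule conjI)
    show "\<forall>\<alpha>\<in>Field k. \<forall>\<beta>\<in>Field k. ltw k \<alpha> \<beta> \<longrightarrow> f \<alpha> \<beta> \<in> Field k" unfolding f_def by simp
  qed (intro ballI allI impI, elim conjE, rule main)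
qed

end

section \<open>Strong limits from GCH and singularity\<close>

theorem theorem4p13:
  fixes m k :: "'a rel" and th :: "'a \<Rightarrow> 'a set" and p :: "'a \<Rightarrow> 'a \<Rightarrow> 'a \<Rightarrow> 'a"
  assumes "GCH_on TYPE('a)"
    and "singular_card m"
    and "Card_order k" and "k =o cardSuc m"
    and "\<forall>\<delta>\<in>Field k. card_of (th \<delta>) \<le>o m"
    and "\<forall>\<delta>\<in>Field k. \<forall>\<alpha>\<in>Field k. \<forall>\<beta>\<in>Field k. ltw k \<alpha> \<beta> \<longrightarrow> p \<delta> \<alpha> \<beta> \<in> th \<delta>"
  shows "Pr0_seq k m th p"
proof -
  have m: "Card_order m" "infinite (Field m)" "\<not> regularCard m"
    using assms(2) unfolding singular_card_def by auto
  have Field_m: "|Field m| =o m" by (rule card_of_Field_ordIso[OF m(1)])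
  \<comment> \<open>The successor of |Y| is realised on sets of elements of the base type, so its
    field is an admissible \<open>C\<close> in \<open>GCH_on\<close>.\<close>
  have GCH: "|Pow Y| \<le>o cardSuc |Y|" if "infinite Y" for Y :: "'a set"
  proof -
    have eq: "|Field (cardSuc |Y| )| =o cardSuc |Y|"
      by (rule card_of_Field_ordIso[OF cardSuc_Card_order[OF card_of_Card_order]])
    have "|Y| <o |Field (cardSuc |Y| )|"
      by (rule ordLess_ordIso_trans[OF cardSuc_greater[OF card_of_Card_order] ordIso_symmetric[OF eq]])
    then have "|Pow Y| \<le>o |Field (cardSuc |Y| )|"
      using assms(1) that unfolding GCH_on_def by blast
    then show ?thesis using eq by (rule ordLeq_ordIso_trans)
  qed
  have nat_le: "|UNIV :: nat set| \<le>o m"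
    using m(2) infinite_iff_card_of_nat ordLeq_ordIso_trans[OF _ Field_m] by blast
  have "strong_limit_succ m k"
  proof
    show "|UNIV :: nat set| <o m"
    proof (rule ccontr)
      assume "\<not> |UNIV :: nat set| <o m"
      then have "|UNIV :: nat set| =o m" using nat_le ordLeq_iff_ordLess_or_ordIso by blast
      then have "natLeq =o m" by (rule ordIso_transitive[OF ordIso_symmetric[OF card_of_nat]])
      then show False using regularCard_ordIso[OF _ natLeq_Cinfinite regularCard_natLeq] m(3) by blast
    qed
    show "|Pow Y| <o m" if Y: "|Y| <o m" for Y :: "'a set"
    proof (cases "finite Y")
      case True
      then have "|Pow Y| <o |Field m|" by (intro finite_ordLess_infinite_set m(2)) simp
      then show ?thesis using Field_m by (rule ordLess_ordIso_trans)
    next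
      case False
      have "cardSuc |Y| \<le>o m" by (rule cardSuc_least[OF card_of_Card_order m(1) Y])
      \<comment> \<open>An infinite successor is regular, hence differs from the singular
        \<open>m\<close>; so the successor of |Y|, and with it the power set by GCH, stays strictly
        below \<open>m\<close>.\<close>
      moreover have "\<not> cardSuc |Y| =o m"
      proof
        assume "cardSuc |Y| =o m"
        moreover have "Cinfinite (cardSuc |Y| )"
          using False cardSuc_finite[OF card_of_Card_order, of Y]
            cardSuc_Card_order[OF card_of_Card_order, of Y]
          by (simp add: cinfinite_def Field_card_of)
        moreover have "regularCard (cardSuc |Y| )"
          using False by (intro infinite_cardSuc_regularCard) (auto simp: Field_card_of card_of_card_order_on)
        ultimately show False using regularCard_ordIso m(3) by blast
      qed
      ultimately have "cardSuc |Y| <o m" using ordLeq_iff_ordLess_or_ordIso by blast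
      with GCH[OF False] show ?thesis by (rule ordLeq_ordLess_trans)
    qed
    have "cardSuc |Field m| =o cardSuc m"
      by (rule iffD2[OF cardSuc_invar_ordIso[OF card_of_Card_order m(1)] Field_m])
    then have "cardSuc |Field m| =o k" by (rule ordIso_transitive[OF _ ordIso_symmetric[OF assms(4)]])
    then show "|Pow (Field m)| \<le>o k" by (rule ordLeq_ordIso_trans[OF GCH[OF m(2)]])
  qed (rule m(1) assms(3,4))+
  then show ?thesis by (rule strong_limit_succ.Pr0_seq_if_strong_limit) (rule assms(5,6))+
qed

end
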